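(* Let $n,p,d\geq 1$ be integers and let $L>0$. For $i=1,\dots,n$ let $f_i\colon\mathbb{R}^p\to(-\infty,+\infty]$ and $g_i\colon\mathbb{R}^d\to(-\infty,+\infty]$ be proper, lower semicontinuous and convex, and let $\phi_i\colon\mathbb{R}^p\times\mathbb{R}^d\to\mathbb{R}$ be a differentiable convex-concave function with $L$-Lipschitz continuous gradient. Consider the min-max problem $$\min_{x\in\mathbb{R}^p}\max_{y\in\mathbb{R}^d}\sum_{i=1}^n\bigl(f_i(x)+\phi_i(x,y)-g_i(y)\bigr).\qquad (P)$$ Suppose that $(P)$ has a saddle-point and that the sum rules $$\partial\Bigl(\sum_{i=1}^nf_i\Bigr)=\sum_{i=1}^n\partial f_i,\qquad \partial\Bigl(\sum_{i=1}^ng_i\Bigr)=\sum_{i=1}^n\partial g_i$$ hold. Let $W_1,W_2\in\mathbb{R}^{n\times n}$ be mixing matrices (for possibly different connected graphs on the vertex set $\{1,\dots,n\}$), and let $$0<\tau<\frac{1+\min\{\lambda_{\min}(W_1),\lambda_{\min}(W_2)\}}{4L}.$$ Let $\mathbf{x}^0\in\mathbb{R}^{n\times p}$ and $\mathbf{y}^0\in\mathbb{R}^{n\times d}$ be arbitrary, and define sequences $(\mathbf{x}^k)$ and $(\mathbf{y}^k)$ by $$\mathbf{v}^0_x=\nabla_x\phi(\mathbf{x}^0,\mathbf{y}^0),\quad \mathbf{u}^1_x=\mathbf{x}^0-\tau\mathbf{v}^0_x,\quad \mathbf{x}^1=\operatorname{prox}_{\tau f}(\mathbf{u}^1_x),$$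 $$\mathbf{v}^0_y=-\nabla_y\phi(\mathbf{x}^0,\mathbf{y}^0),\quad \mathbf{u}^1_y=\mathbf{y}^0-\tau\mathbf{v}^0_y,\quad \mathbf{y}^1=\operatorname{prox}_{\tau g}(\mathbf{u}^1_y),$$ and, for $k=1,2,\dots$, $$\begin{aligned} \mathbf{v}^k_x&=2\nabla_x\phi(\mathbf{x}^k,\mathbf{y}^k)-\nabla_x\phi(\mathbf{x}^{k-1},\mathbf{y}^{k-1}),\\ \mathbf{u}^{k+1}_x&=W_1\mathbf{x}^k+\mathbf{u}^k_x-\tfrac12(\mathrm{Id}+W_1)\mathbf{x}^{k-1}-\tau(\mathbf{v}^k_x-\mathbf{v}^{k-1}_x),\\ \mathbf{x}^{k+1}&=\operatorname{prox}_{\tau f}(\mathbf{u}^{k+1}_x), \end{aligned}$$ $$\begin{aligned} \mathbf{v}^k_y&=-2\nabla_y\phi(\mathbf{x}^k,\mathbf{y}^k)+\nabla_y\phi(\mathbf{x}^{k-1},\mathbf{y}^{k-1}),\\ \mathbf{u}^{k+1}_y&=W_2\mathbf{y}^k+\mathbf{u}^k_y-\tfrac12(\mathrm{Id}+W_2)\mathbf{y}^{k-1}-\tau(\mathbf{v}^k_y-\mathbf{v}^{k-1}_y),\\ \mathbf{y}^{k+1}&=\operatorname{prox}_{\tau g}(\mathbf{u}^{k+1}_y). \end{aligned}$$ Then $(\mathbf{x}^k)$ and $(\mathbf{y}^k)$ converge, respectively, to points $\mathbf{x}=(x,\dots,x)^\top\in\mathbb{R}^{n\times p}$ and $\mathbf{y}=(y,\dots,y)^\top\in\mathbb{R}^{n\times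 d}$ such that $(x,y)$ is a solution (saddle-point) of $(P)$.
   Context: Elements of $\mathbb{R}^{n\times p}$ are written $\mathbf{x}=(x_1,\dots,x_n)^\top$ with rows $x_i^\top$, $x_i\in\mathbb{R}^p$ (similarly $\mathbf{y}\in\mathbb{R}^{n\times d}$ with $y_i\in\mathbb{R}^d$). Notation: $f(\mathbf{x})=\sum_{i=1}^nf_i(x_i)$, $g(\mathbf{y})=\sum_{i=1}^ng_i(y_i)$, $\phi(\mathbf{x},\mathbf{y})=\sum_{i=1}^n\phi_i(x_i,y_i)$; thus the $i$th rows of $\nabla_x\phi(\mathbf{x},\mathbf{y})$ and $\nabla_y\phi(\mathbf{x},\mathbf{y})$ are $\nabla_x\phi_i(x_i,y_i)^\top$ and $\nabla_y\phi_i(x_i,y_i)^\top$. The proximal operator of a proper lsc convex function $h$ is $\operatorname{prox}_h(x)=\operatorname{argmin}_u\{h(u)+\frac12\|x-u\|^2\}$, with Euclidean norm; in particular $\operatorname{prox}_{\tau f}$ and $\operatorname{prox}_{\tau g}$ act row-wise through $\operatorname{prox}_{\tau f_i}$ and $\operatorname{prox}_{\tau g_i}$. Convex-concave means $\phi_i(\cdot,y)$ is convex for every $y$ and $\phi_i(x,\cdot)$ is concave for every $x$. Subdifferential: $\partial h(x_0)=\{v: h(x_0)+\langle v,x-x_0\rangle\leq h(x)\ \forall x\}$ if $h(x_0)<+\infty$, and $\partial h(x_0)=\emptyset$ otherwise. Equalities of subdifferentials are equalities of set-valued maps, with Minkowski sums on the right. A saddle-point (solution) of $(P)$ is a pair $(x^*,y^*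 )$ with $f_i(x^* )<+\infty$ and $g_i(y^* )<+\infty$ for all $i$ such that, writing $\Psi(x,y)=\sum_{i=1}^n(f_i(x)+\phi_i(x,y)-g_i(y))$, one has $\Psi(x^*,y)\leq\Psi(x^*,y^* )\leq\Psi(x,y^* )$ for all $x\in\mathbb{R}^p$, $y\in\mathbb{R}^d$. Mixing matrix: given a simple undirected connected graph with vertex set $\{1,\dots,n\}$ and edge set $\mathcal{E}$, a matrix $W=(w_{ij})\in\mathbb{R}^{n\times n}$ is a mixing matrix if (a) $w_{ij}=0$ whenever $i\neq j$ and $(i,j)\notin\mathcal{E}$; (b) $W=W^\top$; (c) $\ker(\mathrm{Id}-W)=\{x\in\mathbb{R}^n: x_1=\dots=x_n\}$; (d) $\mathrm{Id}\succeq W\succ-\mathrm{Id}$, i.e. $\mathrm{Id}-W$ is positive semidefinite and $W+\mathrm{Id}$ is positive definite. $\lambda_{\min}(W)$ denotes the smallest eigenvalue of $W$. *)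

theory Defs
  imports "HOL-Analysis.Analysis"
begin

section \<open>Extended-valued convex functions\<close>

definition proper :: "('a \<Rightarrow> ereal) \<Rightarrow> bool" where
  "proper h \<longleftrightarrow> (\<forall>x. h x \<noteq> -\<infinity>) \<and> (\<exists>x. h x \<noteq> \<infinity>)"

definition lower_semicontinuous :: "('a::topological_space \<Rightarrow> ereal) \<Rightarrow> bool" where
  "lower_semicontinuous h \<longleftrightarrow> (\<forall>x. h x \<le> Liminf (at x) h)"

text \<open>Only applied to functions that never take the value \<open>-\<infinity>\<close>, so the right-hand
  side is never of the form \<open>\<infinity> - \<infinity>\<close>; also \<open>0 * \<infinity> = 0\<close> in \<^typ>\<open>ereal\<close>.\<close>

definition ereal_convex :: "('a::real_vector \<Rightarrow> ereal) \<Rightarrow> bool" where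
  "ereal_convex h \<longleftrightarrow>
     (\<forall>x y. \<forall>u\<ge>0. \<forall>v\<ge>0. u + v = 1 \<longrightarrow>
        h (u *\<^sub>R x + v *\<^sub>R y) \<le> ereal u * h x + ereal v * h y)"

definition subdifferential :: "('a::real_inner \<Rightarrow> ereal) \<Rightarrow> 'a \<Rightarrow> 'a set" where
  "subdifferential h x0 =
     (if h x0 < \<infinity> then {v. \<forall>x. h x0 + ereal (v \<bullet> (x - x0)) \<le> h x} else {})"

definition prox :: "('a::real_inner \<Rightarrow> ereal) \<Rightarrow> 'a \<Rightarrow> 'a" where
  "prox h x = (ARG_MIN (\<lambda>u. h u + ereal (1/2 * (norm (x - u))\<^sup>2)) u. True)"

definition gradient :: "('a::real_inner \<Rightarrow> real) \<Rightarrow> 'a \<Rightarrow> 'a" where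
  "gradient h x = (THE D. GDERIV h x :> D)"


section \<open>Functions of stacked variables\<close>

text \<open>A matrix in \<open>\<real>\<^bsup>n\<times>p\<^esup>\<close> is an element of \<^typ>\<open>real^'p^'n\<close>, with rows \<open>\<^bold>x $ i\<close>; its norm is
  the Frobenius norm.\<close>

definition stacked_sum :: "('n::finite \<Rightarrow> real^'p \<Rightarrow> ereal) \<Rightarrow> real^'p^'n \<Rightarrow> ereal" where
  "stacked_sum h x = (\<Sum>i\<in>UNIV. h i (x $ i))"

definition stacked_coupling ::
    "('n::finite \<Rightarrow> (real^'p) \<times> (real^'d) \<Rightarrow> real) \<Rightarrow> real^'p^'n \<Rightarrow> real^'d^'n \<Rightarrow> real" where
  "stacked_coupling \<phi> x y = (\<Sum>i\<in>UNIV. \<phi> i (x $ i, y $ i))"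

definition grad_x ::
    "('n::finite \<Rightarrow> (real^'p) \<times> (real^'d) \<Rightarrow> real) \<Rightarrow> real^'p^'n \<Rightarrow> real^'d^'n \<Rightarrow> real^'p^'n" where
  "grad_x \<phi> x y = gradient (\<lambda>x'. stacked_coupling \<phi> x' y) x"

definition grad_y ::
    "('n::finite \<Rightarrow> (real^'p) \<times> (real^'d) \<Rightarrow> real) \<Rightarrow> real^'p^'n \<Rightarrow> real^'d^'n \<Rightarrow> real^'d^'n" where
  "grad_y \<phi> x y = gradient (\<lambda>y'. stacked_coupling \<phi> x y') y"


section \<open>Saddle-points\<close>

definition saddle_objective ::
    "('n::finite \<Rightarrow> real^'p \<Rightarrow> ereal) \<Rightarrow> ('n \<Rightarrow> (real^'p) \<times> (real^'d) \<Rightarrow> real) \<Rightarrow>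
     ('n \<Rightarrow> real^'d \<Rightarrow> ereal) \<Rightarrow> real^'p \<Rightarrow> real^'d \<Rightarrow> ereal" where
  "saddle_objective f \<phi> g x y = (\<Sum>i\<in>UNIV. f i x + ereal (\<phi> i (x, y)) - g i y)"

text \<open>The objective can be of the form \<open>\<infinity> - \<infinity>\<close> only at points \<open>(x, y)\<close> where both some \<open>f i x\<close>
  and some \<open>g j y\<close> are infinite. By the first two conjuncts no such point is evaluated below.\<close>

definition saddle_point ::
    "('n::finite \<Rightarrow> real^'p \<Rightarrow> ereal) \<Rightarrow> ('n \<Rightarrow> (real^'p) \<times> (real^'d) \<Rightarrow> real) \<Rightarrow>
     ('n \<Rightarrow> real^'d \<Rightarrow> ereal) \<Rightarrow> real^'p \<Rightarrow> real^'d \<Rightarrow> bool" where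
  "saddle_point f \<phi> g x' y' \<longleftrightarrow>
     (\<forall>i. f i x' < \<infinity>) \<and> (\<forall>i. g i y' < \<infinity>) \<and>
     (\<forall>x y. saddle_objective f \<phi> g x' y \<le> saddle_objective f \<phi> g x' y' \<and>
            saddle_objective f \<phi> g x' y' \<le> saddle_objective f \<phi> g x y')"


section \<open>Mixing matrices\<close>

text \<open>The vertex set is the whole type; an undirected edge is represented by both of its
  orientations.\<close>

definition simple_connected_graph :: "('n \<times> 'n) set \<Rightarrow> bool" where
  "simple_connected_graph E \<longleftrightarrow> sym E \<and> irrefl E \<and> (\<forall>i j. (i, j) \<in> E\<^sup>*)"

definition mixing_matrix :: "('n::finite \<times> 'n) set \<Rightarrow> real^'n^'n \<Rightarrow> bool" where
  "mixing_matrix E W \<longleftrightarrow>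
     (\<forall>i j. i \<noteq> j \<and> (i, j) \<notin> E \<longrightarrow> W $ i $ j = 0) \<and>
     W = transpose W \<and>
     {x. (mat 1 - W) *v x = 0} = {x. \<forall>i j. x $ i = x $ j} \<and>
     (\<forall>x. 0 \<le> x \<bullet> ((mat 1 - W) *v x)) \<and>
     (\<forall>x. x \<noteq> 0 \<longrightarrow> 0 < x \<bullet> ((W + mat 1) *v x))"

definition is_eigenvalue :: "real^'n^'n \<Rightarrow> real \<Rightarrow> bool" where
  "is_eigenvalue W l \<longleftrightarrow> (\<exists>v. v \<noteq> 0 \<and> W *v v = l *\<^sub>R v)"

definition lambda_min :: "real^'n^'n \<Rightarrow> real" where
  "lambda_min W = (LEAST l. is_eigenvalue W l)"

end

theory Submission
  imports Defs
begin

text \<open>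
  Both updates are one iteration in disguise. Write \<open>U = (Id - W) / 2\<close>, with \<open>W\<close> acting on stacked
  vectors (\<open>W1\<close> on \<open>x\<close>, \<open>W2\<close> on \<open>y\<close>). Then \<open>U\<close> is positive semidefinite, its kernel consists of the
  stacked vectors with equal rows, and \<open>Id - U = (Id + W) / 2\<close> is positive definite with smallest eigenvalue
  \<open>(1 + lambda_min W) / 2\<close>. The recursion for \<open>u\<close> telescopes (\<open>mixing_recursion_closed_form\<close>); with the
  accumulated multiplier \<open>s k = (\<Sum>j=1..k. x j) - x 0\<close> the proximal step becomes, from the
  second one on, the inclusion

    \<open>(Id - U) (z k - z (k+1)) - U (s (k+1)) - \<tau> (2 F (z k) - F (z (k-1))) \<in> \<tau> \<partial>h (z (k+1))\<close>,

  where \<open>z = (x, y)\<close>, \<open>F = (\<nabla>\<^sub>x\<phi>, -\<nabla>\<^sub>y\<phi>)\<close> and \<open>h (x, y) = f x + g y\<close>. Its limits should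
  solve \<open>U z = 0\<close>, \<open>0 \<in> \<partial>h z + F z + U r / \<tau>\<close> for some multiplier \<open>r\<close>.

  The operator \<open>F\<close> is monotone because \<open>\<phi>\<close> is convex-concave, and \<open>L\<close>-Lipschitz. Testing the inclusion
  against a solution makes a Lyapunov function decrease (\<open>lyapunov_decrease\<close>): it is the squared
  distance to the solution in the metric \<open>Id - U\<close>, plus the squared distance of the multipliers in
  the seminorm of \<open>U\<close>, plus a correction for the reflected value of \<open>F\<close>. The correction costs
  \<open>2 \<tau> L\<close> times a squared increment, which the metric absorbs exactly when \<open>2 \<tau> L\<close> is less than the
  smallest eigenvalue of \<open>Id - U\<close>; that is the condition on \<open>\<tau>\<close>. Hence the iterates are bounded and the
  increments vanish, every cluster point solves the inclusion since subdifferentials have closed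
  graphs, and Opial's argument gives convergence of the whole sequence (\<open>converges_to_kkt\<close>).

  Solutions of the inclusion correspond to saddle-points. By Fermat's rule a saddle-point is a zero of
  \<open>\<partial>(\<Sum>i. f\<^sub>i) + \<Sum>i. \<nabla>\<^sub>x\<phi>\<^sub>i\<close> and of its counterpart in \<open>y\<close> (\<open>saddle_point_iff\<close>). The sum rule splits
  that zero into one subgradient per row; together with the gradients these have row sum \<open>0\<close>, hence lie in
  the range of \<open>U\<close>, which yields the multiplier (\<open>stacked_subgradient_exists\<close>). Conversely, adding the
  rows of the inclusion at a point with equal rows removes the multiplier
  (\<open>consensus_subgradient\<close>).
\<close>

section \<open>Lower semicontinuous convex functions\<close>

text \<open>Openness of the strict superlevel sets is the form in which lower semicontinuity passes to
  sums and compositions and meets compactness.\<close>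

lemma lower_semicontinuous_iff_open:
  "lower_semicontinuous h \<longleftrightarrow> (\<forall>c. open {x. c < h x})"
proof
  assume lsc: "lower_semicontinuous h"
  show "\<forall>c. open {x. c < h x}"
  proof
    fix c
    show "open {x. c < h x}"
    proof (subst open_subopen, intro ballI)
      fix x assume "x \<in> {x. c < h x}"
      then have x: "c < h x" by simp
      have "eventually (\<lambda>w. c < h w) (at x)"
        using lsc x unfolding lower_semicontinuous_def le_Liminf_iff by blast
      then have "eventually (\<lambda>w. c < h w) (nhds x)"
        using x unfolding eventually_at_filter
        by (auto elim!: eventually_mono)
      then show "\<exists>T. open T \<and> x \<in> T \<and> T \<subseteq> {x. c < h x}"
        unfolding eventually_nhds by blast
    qed
  qed
next
  assume op: "\<forall>c. open {x. c < h x}"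
  show "lower_semicontinuous h"
    unfolding lower_semicontinuous_def le_Liminf_iff
  proof (intro allI impI)
    fix x c assume "c < h x"
    then show "eventually (\<lambda>w. c < h w) (at x)"
      using op unfolding eventually_at_topological by blast
  qed
qed

lemma ereal_less_add_split:
  fixes c p q :: ereal
  assumes "c < p + q" "p \<noteq> -\<infinity>" "q \<noteq> -\<infinity>"
  obtains a b where "a < p" "b < q" "c \<le> a + b"
proof -
  have "\<exists>a<p. \<exists>b<q. c \<le> a + b"
  proof (cases c)
    case (real r)
    show ?thesis
    proof (cases p)
      case (real s)
      show ?thesis
      proof (cases q)
        case (real t)
        have "ereal (s - (s + t - r) / 2) < p" "ereal (t - (s + t - r) / 2) < q"
          using assms \<open>c = ereal r\<close> \<open>p = ereal s\<close> real by auto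
        moreover have "c \<le> ereal (s - (s + t - r) / 2) + ereal (t - (s + t - r) / 2)"
          using \<open>c = ereal r\<close> by (simp add: field_simps)
        ultimately show ?thesis by blast
      next
        case PInf
        have "ereal (s - 1) < p" "ereal (r - s + 1) < q" "c \<le> ereal (s - 1) + ereal (r - s + 1)"
          using \<open>c = ereal r\<close> \<open>p = ereal s\<close> PInf by auto
        then show ?thesis by blast
      qed (use assms in auto)
    next
      case PInf
      obtain t where t: "ereal t < q" using assms(3)
        by (metis ereal_dense2 MInfty_neq_ereal(1) ereal_less(6) ereal_infty_less(2))
      have "ereal (r - t) < p" "c \<le> ereal (r - t) + ereal t"
        using \<open>c = ereal r\<close> PInf by auto
      with t show ?thesis by blast
    qed (use assms in auto)
  next
    case MInf
    have "-\<infinity> < p" "-\<infinity> < q" using assms by auto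
    then show ?thesis using MInf by (intro exI[of _ "-\<infinity>"] conjI) auto
  qed (use assms in auto)
  then show ?thesis using that by blast
qed

lemma lower_semicontinuous_add:
  assumes "lower_semicontinuous h" "lower_semicontinuous k"
    and "\<And>x. h x \<noteq> -\<infinity>" "\<And>x. k x \<noteq> -\<infinity>"
  shows "lower_semicontinuous (\<lambda>x. h x + k x)"
  unfolding lower_semicontinuous_iff_open
proof
  fix c
  \<comment> \<open>an uncountable union is harmless here, since only openness has to be preserved\<close>
  have "{x. c < h x + k x} =
      (\<Union>(a, b)\<in>{(a, b). c \<le> a + b}. {x. a < h x} \<inter> {x. b < k x})" (is "?L = ?R")
  proof
    show "?L \<subseteq> ?R"
    proof
      fix x assume "x \<in> ?L"
      then obtain a b where "a < h x" "b < k x" "c \<le> a + b"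
        using ereal_less_add_split assms(3,4) by (metis mem_Collect_eq)
      then show "x \<in> ?R" by auto
    qed
    show "?R \<subseteq> ?L"
    proof clarify
      fix x a b assume "c \<le> a + b" "a < h x" "b < k x"
      then show "c < h x + k x"
        using ereal_add_strict_mono2 [of a "h x" b "k x"] by (meson order_le_less_trans)
    qed
  qed
  also have "open \<dots>"
    using assms(1,2) unfolding lower_semicontinuous_iff_open
    by (auto intro!: open_UN open_Int)
  finally show "open {x. c < h x + k x}" .
qed

lemma sum_ereal_neq_MInfty:
  fixes h :: "'i \<Rightarrow> ereal"
  assumes "\<And>i. i \<in> I \<Longrightarrow> h i \<noteq> -\<infinity>"
  shows "sum h I \<noteq> -\<infinity>"
  using assms by (induction I rule: infinite_finite_induct) auto

lemma lower_semicontinuous_sum: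
  assumes "\<And>i. i \<in> I \<Longrightarrow> lower_semicontinuous (h i)" "\<And>i x. i \<in> I \<Longrightarrow> h i x \<noteq> -\<infinity>"
  shows "lower_semicontinuous (\<lambda>x. \<Sum>i\<in>I. h i x)"
  using assms
proof (induction I rule: infinite_finite_induct)
  case (insert i I)
  then show ?case
    by (simp add: lower_semicontinuous_add sum_ereal_neq_MInfty)
qed (auto simp: lower_semicontinuous_iff_open)

lemma lower_semicontinuous_compose:
  assumes "lower_semicontinuous h" "continuous_on UNIV l"
  shows "lower_semicontinuous (\<lambda>x. h (l x))"
  unfolding lower_semicontinuous_iff_open
proof
  fix c
  have "open (l -` {y. c < h y})"
    using assms open_vimage unfolding lower_semicontinuous_iff_open by blast
  then show "open {x. c < h (l x)}" by (simp add: vimage_def)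
qed

lemma lower_semicontinuous_ereal:
  assumes "continuous_on UNIV \<psi>"
  shows "lower_semicontinuous (\<lambda>x. ereal (\<psi> x))"
  unfolding lower_semicontinuous_iff_open
proof
  fix c
  show "open {x. c < ereal (\<psi> x)}"
    by (cases c) (use assms in \<open>auto intro: open_Collect_less continuous_intros\<close>)
qed

lemma lower_semicontinuous_scale:
  fixes h :: "'a::topological_space \<Rightarrow> ereal"
  assumes "lower_semicontinuous h" "t > 0"
  shows "lower_semicontinuous (\<lambda>x. ereal t * h x)"
  unfolding lower_semicontinuous_iff_open
proof
  fix c
  have "c < ereal t * e \<longleftrightarrow> ereal (1/t) * c < e" for e
    using assms(2) by (cases c; cases e) (auto simp: field_simps)
  then show "open {x. c < ereal t * h x}"
    using assms(1) unfolding lower_semicontinuous_iff_open by simp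
qed

lemma lower_semicontinuous_le_limit:
  assumes lsc: "lower_semicontinuous h" and "a \<longlonglongrightarrow> a'" and "r \<longlonglongrightarrow> r'"
    and le: "\<And>k::nat. h (a k) \<le> ereal (r k)"
  shows "h a' \<le> ereal r'"
proof (rule dense_le)
  fix c assume "c < h a'"
  then have "eventually (\<lambda>k. a k \<in> {x. c < h x}) sequentially"
    using lsc assms(2) topological_tendstoD unfolding lower_semicontinuous_iff_open by blast
  then have "eventually (\<lambda>k. c \<le> ereal (r k)) sequentially"
    by eventually_elim (use le in \<open>auto intro: order.strict_implies_order less_le_trans\<close>)
  moreover have "(\<lambda>k. ereal (r k)) \<longlonglongrightarrow> ereal r'" using assms(3) by simp
  ultimately show "c \<le> ereal r'" using tendsto_lowerbound sequentially_bot by blast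
qed

lemma lower_semicontinuous_attains_min:
  fixes h :: "'a::topological_space \<Rightarrow> ereal"
  assumes lsc: "lower_semicontinuous h" and "compact K" "K \<noteq> {}"
  obtains u where "u \<in> K" "\<And>w. w \<in> K \<Longrightarrow> h u \<le> h w"
proof (rule ccontr)
  assume "\<not> thesis"
  then have "\<And>u. u \<in> K \<Longrightarrow> \<exists>w\<in>K. h w < h u" using that not_le by blast
  then have cover: "K \<subseteq> (\<Union>w\<in>K. {u. h w < h u})" by blast
  obtain D where D: "D \<subseteq> K" "finite D" "K \<subseteq> (\<Union>w\<in>D. {u. h w < h u})"
    using compactE_image[OF \<open>compact K\<close> _ cover] lsc
    unfolding lower_semicontinuous_iff_open by blast
  have "D \<noteq> {}" using D assms(3) by auto
  obtain w where w: "w \<in> D" "\<And>v. v \<in> D \<Longrightarrow> h w \<le> h v"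
    using ex_is_arg_min_if_finite[OF D(2) \<open>D \<noteq> {}\<close>, of h] by (auto simp: is_arg_min_linorder)
  from w D obtain v where "v \<in> D" "h v < h w" by blast
  with w show False by (simp add: leD)
qed

lemma ereal_convex_add:
  assumes h: "ereal_convex h" "\<And>x. h x \<noteq> -\<infinity>" and k: "ereal_convex k" "\<And>x. k x \<noteq> -\<infinity>"
  shows "ereal_convex (\<lambda>x. h x + k x)"
  unfolding ereal_convex_def
proof (intro allI impI)
  fix x y and u v :: real assume uv: "0 \<le> u" "0 \<le> v" "u + v = 1"
  have "h (u *\<^sub>R x + v *\<^sub>R y) + k (u *\<^sub>R x + v *\<^sub>R y)
      \<le> (ereal u * h x + ereal v * h y) + (ereal u * k x + ereal v * k y)"
    using h(1) k(1) uv unfolding ereal_convex_def by (intro add_mono) auto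
  also have "\<dots> = ereal u * (h x + k x) + ereal v * (h y + k y)"
    using h(2) k(2) by (subst (1 2) ereal_distrib_left) (auto simp: ac_simps)
  finally show "h (u *\<^sub>R x + v *\<^sub>R y) + k (u *\<^sub>R x + v *\<^sub>R y)
      \<le> ereal u * (h x + k x) + ereal v * (h y + k y)" .
qed

lemma ereal_convex_sum:
  assumes "\<And>i. i \<in> I \<Longrightarrow> ereal_convex (h i)" "\<And>i x. i \<in> I \<Longrightarrow> h i x \<noteq> -\<infinity>"
  shows "ereal_convex (\<lambda>x. \<Sum>i\<in>I. h i x)"
  using assms
proof (induction I rule: infinite_finite_induct)
  case (insert i I)
  then show ?case by (simp add: ereal_convex_add sum_ereal_neq_MInfty)
qed (auto simp: ereal_convex_def)

lemma ereal_convex_compose_linear: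
  assumes "ereal_convex h" "linear l"
  shows "ereal_convex (\<lambda>x. h (l x))"
  using assms by (simp add: ereal_convex_def linear_add linear_scale)

lemma ereal_convex_scale:
  fixes h :: "'a::real_vector \<Rightarrow> ereal"
  assumes "ereal_convex h" "\<And>x. h x \<noteq> -\<infinity>" "t > 0"
  shows "ereal_convex (\<lambda>x. ereal t * h x)"
  unfolding ereal_convex_def
proof (intro allI impI)
  fix x y and u v :: real assume uv: "0 \<le> u" "0 \<le> v" "u + v = 1"
  have "ereal t * h (u *\<^sub>R x + v *\<^sub>R y) \<le> ereal t * (ereal u * h x + ereal v * h y)"
    using assms uv unfolding ereal_convex_def by (intro ereal_mult_left_mono) auto
  also have "\<dots> = ereal u * (ereal t * h x) + ereal v * (ereal t * h y)"
    using uv assms(2)[of x] assms(2)[of y]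
    by (subst ereal_distrib_left) (auto simp: mult.left_commute)
  finally show "ereal t * h (u *\<^sub>R x + v *\<^sub>R y)
      \<le> ereal u * (ereal t * h x) + ereal v * (ereal t * h y)" .
qed

section \<open>Gradients\<close>

lemma gradient_eqI:
  assumes "GDERIV h x :> D"
  shows "gradient h x = D"
  unfolding gradient_def
proof (rule the_equality)
  show "GDERIV h x :> D" by (rule assms)
next
  fix D' assume "GDERIV h x :> D'"
  then have "(\<lambda>v. v \<bullet> D') = (\<lambda>v. v \<bullet> D)"
    using assms unfolding gderiv_def by (rule has_derivative_unique)
  then show "D' = D" by (metis vector_eq_ldot)
qed

lemma GDERIV_gradient:
  fixes h :: "'a::euclidean_space \<Rightarrow> real"
  assumes "h differentiable at x"
  shows "GDERIV h x :> gradient h x"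
proof -
  obtain h' where h': "(h has_derivative h') (at x)"
    using assms unfolding differentiable_def by blast
  \<comment> \<open>the adjoint of the derivative, applied to \<open>1\<close>, is its Riesz representative\<close>
  have "h' = (\<lambda>v. v \<bullet> adjoint h' 1)"
    using adjoint_works[OF has_derivative_linear[OF h'], of _ 1] by (auto simp: fun_eq_iff)
  with h' have "GDERIV h x :> adjoint h' 1" unfolding gderiv_def by simp
  then show ?thesis using gradient_eqI by metis
qed

lemma GDERIV_along_line:
  assumes "GDERIV \<psi> a :> D"
  shows "((\<lambda>t. \<psi> (a + t *\<^sub>R v)) has_real_derivative v \<bullet> D) (at 0)"
proof -
  have "((\<lambda>t. a + t *\<^sub>R v) has_derivative (\<lambda>t. t *\<^sub>R v)) (at 0)"
    by (auto intro!: derivative_eq_intros)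
  moreover have "(\<psi> has_derivative (\<lambda>h. h \<bullet> D)) (at (a + 0 *\<^sub>R v))"
    using assms unfolding gderiv_def by simp
  ultimately have "((\<lambda>t. \<psi> (a + t *\<^sub>R v)) has_derivative (\<lambda>t. (t *\<^sub>R v) \<bullet> D)) (at 0)"
    using has_derivative_compose[of "\<lambda>t. a + t *\<^sub>R v" "\<lambda>t. t *\<^sub>R v" 0 UNIV \<psi> "\<lambda>h. h \<bullet> D"] by simp
  then show ?thesis
    unfolding has_field_derivative_def by (simp add: mult.commute mult_commute_abs)
qed

lemma derivative_nonneg_if_right_min:
  fixes \<theta> :: "real \<Rightarrow> real"
  assumes "(\<theta> has_real_derivative d) (at 0)" and min: "\<And>t. 0 < t \<Longrightarrow> t \<le> 1 \<Longrightarrow> \<theta> 0 \<le> \<theta> t"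
  shows "0 \<le> d"
proof (rule ccontr)
  assume "\<not> 0 \<le> d"
  then obtain e where e: "e > 0" "\<And>t. t > 0 \<Longrightarrow> t < e \<Longrightarrow> \<theta> (0 + t) < \<theta> 0"
    using DERIV_neg_dec_right[OF assms(1)] by force
  have "\<theta> (0 + min (e/2) 1) < \<theta> 0" using e(1) by (intro e(2)) auto
  then show False using min[of "min (e/2) 1"] e(1) by auto
qed

lemma convex_on_above_tangent_gradient:
  assumes "convex_on UNIV \<psi>" "GDERIV \<psi> a :> D"
  shows "\<psi> a + (w - a) \<bullet> D \<le> \<psi> w"
proof -
  let ?\<theta> = "\<lambda>t. t * (\<psi> w - \<psi> a) - \<psi> (a + t *\<^sub>R (w - a))"
  have "(?\<theta> has_real_derivative (\<psi> w - \<psi> a) - (w - a) \<bullet> D) (at 0)"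
    using GDERIV_along_line[OF assms(2)] by (auto intro!: derivative_eq_intros)
  moreover have "?\<theta> 0 \<le> ?\<theta> t" if "0 < t" "t \<le> 1" for t
    using convex_onD[OF assms(1), of t a w] that by (simp add: algebra_simps)
  ultimately show ?thesis using derivative_nonneg_if_right_min[of ?\<theta>] by force
qed

section \<open>Subdifferentials and the proximal map\<close>

lemma subdifferential_finite:
  assumes "v \<in> subdifferential h a"
  shows "h a < \<infinity>"
  using assms unfolding subdifferential_def by (auto split: if_splits)

lemma subdifferentialD:
  assumes "v \<in> subdifferential h a"
  shows "h a + ereal (v \<bullet> (w - a)) \<le> h w"
  using assms unfolding subdifferential_def by (auto split: if_splits)

lemma scaleR_in_subdifferential_scale:
  fixes h :: "'a::real_inner \<Rightarrow> ereal"
  assumes "t > 0"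
  shows "t *\<^sub>R v \<in> subdifferential (\<lambda>x. ereal t * h x) a \<longleftrightarrow> v \<in> subdifferential h a"
proof -
  have "ereal t * h a + ereal (t *\<^sub>R v \<bullet> (w - a)) \<le> ereal t * h w \<longleftrightarrow>
      h a + ereal (v \<bullet> (w - a)) \<le> h w" for w
  proof (cases "h a"; cases "h w")
    fix r r' assume "h a = ereal r" "h w = ereal r'"
    then show ?thesis
      using assms mult_le_cancel_left_pos[OF assms, of "r + v \<bullet> (w - a)" r']
      by (simp add: algebra_simps)
  qed (use assms in auto)
  moreover have "ereal t * h a < \<infinity> \<longleftrightarrow> h a < \<infinity>" using assms by (cases "h a") auto
  ultimately show ?thesis unfolding subdifferential_def by simp
qed

lemma subdifferential_monotone:
  assumes v: "v \<in> subdifferential h a" and w: "w \<in> subdifferential h b"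
    and ninf: "\<And>x. h x \<noteq> -\<infinity>"
  shows "0 \<le> (v - w) \<bullet> (a - b)"
proof -
  obtain \<alpha> \<beta> where "h a = ereal \<alpha>" "h b = ereal \<beta>"
    using subdifferential_finite[OF v] subdifferential_finite[OF w] ninf[of a] ninf[of b]
    by (cases "h a"; cases "h b") auto
  then show ?thesis
    using subdifferentialD[OF v, of b] subdifferentialD[OF w, of a] by (simp add: inner_simps)
qed

text \<open>The inequalities that define \<open>v k \<in> \<partial>h (a k)\<close> depend continuously on \<open>a k\<close> and \<open>v k\<close> except for
  the term \<open>h (a k)\<close>, and there lower semicontinuity preserves them.\<close>

lemma subdifferential_closed_graph:
  assumes lsc: "lower_semicontinuous h" and ninf: "\<And>x. h x \<noteq> -\<infinity>"
    and v: "\<And>k::nat. v k \<in> subdifferential h (a k)" and lim: "a \<longlonglongrightarrow> a'" "v \<longlonglongrightarrow> v'"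
  shows "v' \<in> subdifferential h a'"
proof -
  have *: "h a' \<le> ereal (\<beta> - v' \<bullet> (w - a'))" if "h w = ereal \<beta>" for w \<beta>
  proof (rule lower_semicontinuous_le_limit[OF lsc lim(1)])
    show "(\<lambda>k. \<beta> - v k \<bullet> (w - a k)) \<longlonglongrightarrow> \<beta> - v' \<bullet> (w - a')"
      by (intro tendsto_intros lim)
    show "h (a k) \<le> ereal (\<beta> - v k \<bullet> (w - a k))" for k
      using subdifferentialD[OF v, of k w] that ninf[of "a k"]
      by (cases "h (a k)") auto
  qed
  obtain \<beta>0 where "h (a 0) = ereal \<beta>0"
    using subdifferential_finite[OF v, of 0] ninf[of "a 0"] by (cases "h (a 0)") auto
  from *[OF this] have fin: "h a' < \<infinity>" by auto
  have "h a' + ereal (v' \<bullet> (w - a')) \<le> h w" for w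
  proof (cases "h w")
    case (real \<beta>)
    then show ?thesis using *[OF real] fin ninf[of a'] by (cases "h a'") auto
  qed (use ninf in auto)
  with fin show ?thesis unfolding subdifferential_def by simp
qed

text \<open>Fermat's rule. On the segment from \<open>a\<close> to \<open>w\<close> the convex function \<open>h\<close> lies below its chord,
  so adding the chord to \<open>\<psi>\<close> still gives a function of \<open>t\<close> that is minimal at \<open>t = 0\<close>, and its
  derivative at \<open>0\<close> is nonnegative. The rule serves twice: for the proximal map, and for the two
  halves of the saddle-point condition.\<close>

lemma minimizer_imp_neg_gradient_in_subdifferential:
  assumes cvx: "ereal_convex h" and ninf: "\<And>x. h x \<noteq> -\<infinity>" and fin: "h a < \<infinity>"
    and D: "GDERIV \<psi> a :> D"
    and min: "\<And>w. h a + ereal (\<psi> a) \<le> h w + ereal (\<psi> w)"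
  shows "- D \<in> subdifferential h a"
proof -
  obtain \<alpha> where \<alpha>: "h a = ereal \<alpha>" using fin ninf[of a] by (cases "h a") auto
  have "h a + ereal (- D \<bullet> (w - a)) \<le> h w" for w
  proof (cases "h w")
    case (real \<beta>)
    let ?\<theta> = "\<lambda>t. \<psi> (a + t *\<^sub>R (w - a)) + t * (\<beta> - \<alpha>)"
    have "(?\<theta> has_real_derivative (w - a) \<bullet> D + (\<beta> - \<alpha>)) (at 0)"
      using GDERIV_along_line[OF D] by (auto intro!: derivative_eq_intros)
    moreover have "?\<theta> 0 \<le> ?\<theta> t" if t: "0 < t" "t \<le> 1" for t
    proof -
      have "h ((1 - t) *\<^sub>R a + t *\<^sub>R w) \<le> ereal (1 - t) * h a + ereal t * h w"
        using cvx t unfolding ereal_convex_def by (meson diff_ge_0_iff_ge le_add_diff_inverse2 less_imp_le)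
      moreover have "(1 - t) *\<^sub>R a + t *\<^sub>R w = a + t *\<^sub>R (w - a)" by (simp add: algebra_simps)
      ultimately have "h (a + t *\<^sub>R (w - a)) \<le> ereal ((1 - t) * \<alpha> + t * \<beta>)"
        using \<alpha> real by simp
      then have "h (a + t *\<^sub>R (w - a)) + ereal (\<psi> (a + t *\<^sub>R (w - a)))
          \<le> ereal ((1 - t) * \<alpha> + t * \<beta> + \<psi> (a + t *\<^sub>R (w - a)))"
        by (metis add_right_mono plus_ereal.simps(1))
      then have "ereal (\<alpha> + \<psi> a) \<le> ereal ((1 - t) * \<alpha> + t * \<beta> + \<psi> (a + t *\<^sub>R (w - a)))"
        using min[of "a + t *\<^sub>R (w - a)"] \<alpha> by (metis order_trans plus_ereal.simps(1))
      then show ?thesis by (simp add: algebra_simps)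
    qed
    ultimately have "0 \<le> (w - a) \<bullet> D + (\<beta> - \<alpha>)" by (rule derivative_nonneg_if_right_min)
    then show ?thesis using \<alpha> real by (simp add: inner_commute)
  qed (use ninf in auto)
  with fin show ?thesis unfolding subdifferential_def by simp
qed

lemma neg_gradient_in_subdifferential_imp_minimizer:
  assumes v: "- D \<in> subdifferential h a" and \<psi>: "convex_on UNIV \<psi>" "GDERIV \<psi> a :> D"
    and ninf: "\<And>x. h x \<noteq> -\<infinity>"
  shows "h a + ereal (\<psi> a) \<le> h w + ereal (\<psi> w)"
proof -
  obtain \<alpha> where "h a = ereal \<alpha>"
    using subdifferential_finite[OF v] ninf[of a] by (cases "h a") auto
  then show ?thesis
    using subdifferentialD[OF v, of w] convex_on_above_tangent_gradient[OF \<psi>, of w]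
    by (cases "h w") (auto simp: inner_commute)
qed

text \<open>The subgradient at \<open>x0\<close> is assumed because it supplies an affine minorant of \<open>h\<close>: the quadratic
  term dominates that minorant outside a ball around \<open>x0\<close>, so the minimum may be sought over a
  compact set. Fermat's rule then gives the inclusion.\<close>

lemma prox_residual_in_subdifferential:
  fixes h :: "'a::euclidean_space \<Rightarrow> ereal"
  assumes lsc: "lower_semicontinuous h" and cvx: "ereal_convex h" and ninf: "\<And>x. h x \<noteq> -\<infinity>"
    and v: "v \<in> subdifferential h x0"
  shows "x - prox h x \<in> subdifferential h (prox h x)"
proof -
  define \<psi> where "\<psi> u = 1/2 * (norm (x - u))\<^sup>2" for u
  define G where "G u = h u + ereal (\<psi> u)" for u
  obtain \<alpha> where \<alpha>: "h x0 = ereal \<alpha>"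
    using subdifferential_finite[OF v] ninf[of x0] by (cases "h x0") auto
  \<comment> \<open>\<open>G w - G x0\<close> is at least \<open>norm d * (norm d / 2 - norm (v - e))\<close> for \<open>d = w - x0\<close>, \<open>e = x - x0\<close>\<close>
  let ?K = "cball x0 (2 * norm (v - (x - x0)))"
  have "lower_semicontinuous G"
    unfolding G_def \<psi>_def using lsc ninf
    by (intro lower_semicontinuous_add lower_semicontinuous_ereal continuous_intros) auto
  moreover have "compact ?K" "?K \<noteq> {}" by auto
  ultimately obtain u where u: "u \<in> ?K" "\<And>w. w \<in> ?K \<Longrightarrow> G u \<le> G w"
    by (rule lower_semicontinuous_attains_min) blast
  have u_min: "G u \<le> G w" for w
  proof (cases "w \<in> ?K")
    case False
    let ?d = "w - x0" and ?e = "x - x0"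
    have far: "2 * norm (v - ?e) < norm ?d" using False by (simp add: dist_norm norm_minus_commute)
    have "- ((v - ?e) \<bullet> ?d) \<le> norm (v - ?e) * norm ?d"
      using Cauchy_Schwarz_ineq2[of "v - ?e" ?d] by linarith
    also have "\<dots> \<le> 1/2 * norm ?d * norm ?d"
      using far by (intro mult_right_mono) auto
    finally have cs: "0 \<le> 1/2 * (norm ?d)\<^sup>2 + (v - ?e) \<bullet> ?d" by (simp add: power2_eq_square)
    have "\<psi> w = 1/2 * (norm (?e - ?d))\<^sup>2" by (simp add: \<psi>_def)
    also have "\<dots> = \<psi> x0 + 1/2 * (norm ?d)\<^sup>2 - ?e \<bullet> ?d"
      unfolding \<psi>_def power2_norm_eq_inner by (simp add: inner_simps inner_commute field_simps)
    finally have "\<alpha> + \<psi> x0 \<le> \<alpha> + v \<bullet> ?d + \<psi> w"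
      using cs by (simp add: inner_simps)
    moreover have "ereal (\<alpha> + v \<bullet> ?d) \<le> h w" using subdifferentialD[OF v, of w] \<alpha> by simp
    ultimately have "G x0 \<le> G w"
      unfolding G_def \<alpha> by (cases "h w") auto
    moreover have "G u \<le> G x0" using u(2)[of x0] by simp
    ultimately show ?thesis by simp
  qed (rule u(2))
  have "is_arg_min G (\<lambda>_. True) (arg_min G (\<lambda>_. True))"
    unfolding arg_min_def by (rule someI[of _ u]) (use u_min in \<open>simp add: is_arg_min_linorder\<close>)
  then have p_min: "G (prox h x) \<le> G w" for w
    unfolding prox_def G_def \<psi>_def is_arg_min_linorder by auto
  have "G (prox h x) \<le> ereal (\<alpha> + \<psi> x0)" using p_min[of x0] by (simp add: G_def \<alpha>)
  then have fin: "h (prox h x) < \<infinity>" unfolding G_def by (cases "h (prox h x)") auto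
  have "GDERIV \<psi> w :> w - x" for w
    unfolding \<psi>_def power2_norm_eq_inner gderiv_def
    by (auto intro!: derivative_eq_intros simp: inner_simps inner_commute algebra_simps)
  from minimizer_imp_neg_gradient_in_subdifferential[OF cvx ninf fin this] p_min
  show ?thesis by (simp add: G_def)
qed

section \<open>Symmetric positive semidefinite operators\<close>

locale psd_operator =
  fixes U :: "'a::euclidean_space \<Rightarrow> 'a"
  assumes linear: "linear U" and symmetric: "U a \<bullet> b = a \<bullet> U b" and nonneg: "0 \<le> a \<bullet> U a"
begin

text \<open>Expand \<open>0 \<le> \<langle>s - t U s, U (s - t U s)\<rangle>\<close> and take for \<open>t\<close> the reciprocal of a bound on \<open>U\<close>.\<close>

lemma norm_le_form: "\<exists>C>0. \<forall>s. (norm (U s))\<^sup>2 \<le> C * (s \<bullet> U s)"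
proof -
  obtain C where C: "C > 0" "\<And>s. norm (U s) \<le> C * norm s"
    using linear_bounded_pos[OF linear] by blast
  have "(norm (U s))\<^sup>2 \<le> C * (s \<bullet> U s)" for s
  proof -
    define q t where "q = U s" and "t = 1 / C"
    have "q \<bullet> U q \<le> norm q * norm (U q)" by (rule norm_cauchy_schwarz)
    also have "\<dots> \<le> norm q * (C * norm q)" by (intro mult_left_mono C) auto
    finally have quad: "q \<bullet> U q \<le> C * (q \<bullet> q)" by (simp add: dot_square_norm power2_eq_square mult.left_commute)
    have Us: "U (s - t *\<^sub>R q) = q - t *\<^sub>R U q"
      by (simp add: linear_diff[OF linear] linear_scale[OF linear] q_def)
    have sU: "s \<bullet> U q = q \<bullet> q" using symmetric[of s q] by (simp add: q_def)
    have "(s - t *\<^sub>R q) \<bullet> U (s - t *\<^sub>R q) = s \<bullet> q - 2 * (t * (q \<bullet> q)) + t * (t * (q \<bullet> U q))"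
      unfolding Us inner_diff_left inner_diff_right inner_scaleR_left inner_scaleR_right sU
      by (simp add: algebra_simps)
    moreover have "t * (t * (q \<bullet> U q)) \<le> t * (t * (C * (q \<bullet> q)))"
      using quad C(1) by (intro mult_left_mono) (auto simp: t_def)
    moreover have "t * (t * (C * (q \<bullet> q))) = t * (q \<bullet> q)" using C(1) by (simp add: t_def)
    ultimately have "t * (q \<bullet> q) \<le> s \<bullet> q" using nonneg[of "s - t *\<^sub>R q"] by linarith
    then show ?thesis
      unfolding q_def[symmetric] using C(1) by (simp add: t_def power2_norm_eq_inner field_simps)
  qed
  with C(1) show ?thesis by blast
qed

text \<open>The form at \<open>s\<close> depends on \<open>U s\<close> only, so \<open>s\<close> may be replaced by the preimage of \<open>U s\<close> that a
  linear right inverse on the range of \<open>U\<close> selects.\<close>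

lemma form_le_norm: "\<exists>C. \<forall>s. s \<bullet> U s \<le> C * (norm (U s))\<^sup>2"
proof -
  obtain G where G: "linear G" "\<And>s. U (G (U s)) = U s"
    using linear_exists_right_inverse_on[OF linear subspace_UNIV] by auto
  obtain C where C: "C > 0" "\<And>s. norm (G s) \<le> C * norm s"
    using linear_bounded_pos[OF G(1)] by blast
  have "s \<bullet> U s \<le> C * (norm (U s))\<^sup>2" for s
  proof -
    have "s \<bullet> U s = G (U s) \<bullet> U s" by (metis G(2) symmetric inner_commute)
    also have "\<dots> \<le> norm (G (U s)) * norm (U s)" by (rule norm_cauchy_schwarz)
    also have "\<dots> \<le> (C * norm (U s)) * norm (U s)" by (intro mult_right_mono C) auto
    finally show ?thesis by (simp add: power2_eq_square mult.assoc)
  qed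
  then show ?thesis by blast
qed

lemma orthogonal_kernel_imp_in_range:
  assumes "\<And>b. U b = 0 \<Longrightarrow> v \<bullet> b = 0"
  shows "v \<in> range U"
proof -
  have sub: "subspace (range U)" using linear_subspace_image[OF linear subspace_UNIV] .
  obtain a b where ab: "a \<in> span (range U)" "\<And>w. w \<in> span (range U) \<Longrightarrow> orthogonal b w" "v = a + b"
    by (rule orthogonal_subspace_decomp_exists[of "range U" v]) blast
  have a: "a \<in> range U" using ab(1) sub by (simp add: span_eq_iff[THEN iffD2])
  have "U b \<bullet> U b = b \<bullet> U (U b)" by (rule symmetric)
  also have "\<dots> = 0" using ab(2)[OF span_base[OF rangeI]] by (simp add: orthogonal_def)
  finally have "U b = 0" by simp
  then have "v \<bullet> b = 0" by (rule assms)
  moreover have "a \<bullet> b = 0" using ab(1,2) by (simp add: orthogonal_def inner_commute)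
  ultimately have "b = 0" using ab(3) by (simp add: inner_simps)
  with a ab(3) show ?thesis by simp
qed

end

section \<open>A primal-dual forward-reflected-backward iteration\<close>

lemma tendsto_zero_if_norm_square_le:
  fixes v :: "nat \<Rightarrow> 'a::real_normed_vector"
  assumes le: "\<And>k. (norm (v k))\<^sup>2 \<le> C * \<delta> k" and "\<delta> \<longlonglongrightarrow> 0"
  shows "v \<longlonglongrightarrow> 0"
proof -
  have lim: "(\<lambda>k. C * \<delta> k) \<longlonglongrightarrow> 0" using tendsto_mult[OF tendsto_const assms(2), of C] by simp
  have "(\<lambda>k. (norm (v k))\<^sup>2) \<longlonglongrightarrow> 0"
    by (rule tendsto_sandwich[OF _ _ tendsto_const lim]) (simp_all add: le)
  then have "(\<lambda>k. sqrt ((norm (v k))\<^sup>2)) \<longlonglongrightarrow> sqrt 0" by (rule tendsto_real_sqrt)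
  then have "(\<lambda>k. norm (v k)) \<longlonglongrightarrow> 0" by simp
  then show ?thesis by (rule tendsto_norm_zero_cancel)
qed

text \<open>The iteration solves \<open>0 \<in> T a + F a + U r\<close>, \<open>U a = 0\<close>, with \<open>F\<close> evaluated explicitly at a
  reflected value and \<open>T\<close> implicitly, in the metric of \<open>Id - U\<close>. The steplength is absorbed in \<open>F\<close>
  and \<open>T\<close>, and the indices are shifted so that the two predecessors of an iterate exist.\<close>

locale reflected_iteration = psd_operator U for U :: "'a::euclidean_space \<Rightarrow> 'a" +
  fixes F :: "'a \<Rightarrow> 'a" and T :: "'a \<Rightarrow> 'a set" and M \<sigma> :: real and z s :: "nat \<Rightarrow> 'a"
  assumes coercive: "\<sigma> * (norm a)\<^sup>2 \<le> a \<bullet> (a - U a)"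
    and F_monotone: "0 \<le> (F a - F b) \<bullet> (a - b)"
    and F_lipschitz: "norm (F a - F b) \<le> M * norm (a - b)"
    and T_monotone: "v \<in> T a \<Longrightarrow> w \<in> T b \<Longrightarrow> 0 \<le> (v - w) \<bullet> (a - b)"
    and T_closed: "(\<And>k::nat. vs k \<in> T (as k)) \<Longrightarrow> as \<longlonglongrightarrow> a \<Longrightarrow> vs \<longlonglongrightarrow> v \<Longrightarrow> v \<in> T a"
    and M_nonneg: "0 \<le> M" and M_small: "2 * M < \<sigma>"
    and step: "(z (k+1) - z (k+2)) - U (z (k+1) - z (k+2)) - U (s (k+2))
        - (2 *\<^sub>R F (z (k+1)) - F (z k)) \<in> T (z (k+2))"
    and dual_step: "s (k+2) = s (k+1) + z (k+2)"
begin

definition kkt :: "'a \<Rightarrow> 'a \<Rightarrow> bool" where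
  "kkt a r \<longleftrightarrow> U a = 0 \<and> - U r - F a \<in> T a"

text \<open>The first two terms are the squared distances of the iterate and of its multiplier to a solution,
  in the metric \<open>Id - U\<close> and in the seminorm of \<open>U\<close>. The last two belong to the reflection: the
  inner product telescopes, and the square pays for the cross term that the next step produces.\<close>

definition lyapunov :: "'a \<Rightarrow> 'a \<Rightarrow> nat \<Rightarrow> real" where
  "lyapunov a r k =
     (z (k+1) - a) \<bullet> ((z (k+1) - a) - U (z (k+1) - a)) + (s (k+1) - r) \<bullet> U (s (k+1) - r)
     - 2 * ((F (z (k+1)) - F (z k)) \<bullet> (z (k+1) - a)) + M * (norm (z (k+1) - z k))\<^sup>2"

lemma F_cross_bound:
  "2 * \<bar>(F a - F b) \<bullet> c\<bar> \<le> M * (norm (a - b))\<^sup>2 + M * (norm c)\<^sup>2"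
proof -
  have "\<bar>(F a - F b) \<bullet> c\<bar> \<le> norm (F a - F b) * norm c" by (rule Cauchy_Schwarz_ineq2)
  also have "\<dots> \<le> M * norm (a - b) * norm c" by (intro mult_right_mono F_lipschitz) auto
  finally have "2 * \<bar>(F a - F b) \<bullet> c\<bar> \<le> M * (2 * norm (a - b) * norm c)" by simp
  also have "\<dots> \<le> M * ((norm (a - b))\<^sup>2 + (norm c)\<^sup>2)"
    by (intro mult_left_mono M_nonneg sum_squares_bound)
  finally show ?thesis by (simp add: algebra_simps)
qed

text \<open>Monotonicity of \<open>T\<close> and of \<open>F\<close>, tested with \<open>z (k+2) - a\<close>, gives everything: the metric terms
  telescope by polarization, and so do the dual terms, because \<open>U\<close> applied to \<open>z (k+2) - a\<close> is the
  increment of \<open>U s\<close>. The reflected part of \<open>F\<close> leaves the cross term of \<open>F_cross_bound\<close>, which the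
  metric absorbs since \<open>2 * M < \<sigma>\<close>.\<close>

lemma lyapunov_decrease:
  assumes "kkt a r"
  shows "lyapunov a r (k+1) + (\<sigma> - 2 * M) * (norm (z (k+2) - z (k+1)))\<^sup>2 + z (k+2) \<bullet> U (z (k+2))
    \<le> lyapunov a r k"
proof -
  define p q w t0 t where "p = z k" and "q = z (k+1)" and "w = z (k+2)"
    and "t0 = s (k+1) - r" and "t = s (k+2) - r"
  note lin = linear_diff[OF linear]
  have Ua: "U a = 0" using assms by (simp add: kkt_def)
  have t0: "t0 = t - w" using dual_step[of k] by (simp add: t0_def t_def w_def)
  have mono: "0 \<le> ((q - w) - U (q - w) - U t - (2 *\<^sub>R F q - F p) + F a) \<bullet> (w - a)"
    using T_monotone[OF step[of k], of "- U r - F a" a] assms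
    by (simp add: kkt_def p_def q_def w_def t_def lin algebra_simps)
  have metric: "2 * (((q - w) - U (q - w)) \<bullet> (w - a)) =
      (q - a) \<bullet> ((q - a) - U (q - a)) - (w - a) \<bullet> ((w - a) - U (w - a))
      - (w - q) \<bullet> ((w - q) - U (w - q))"
    using symmetric[of q w] symmetric[of q a] symmetric[of w a]
    by (simp add: lin inner_simps inner_commute algebra_simps)
  have dual: "2 * (U t \<bullet> (w - a)) = t \<bullet> U t - t0 \<bullet> U t0 + w \<bullet> U w"
    unfolding t0 using symmetric[of t w] symmetric[of t a] Ua
    by (simp add: lin inner_simps inner_commute algebra_simps)
  have split: "(2 *\<^sub>R F q - F p - F a) \<bullet> (w - a) =
      (F w - F a) \<bullet> (w - a) - (F w - F q) \<bullet> (w - a) + (F q - F p) \<bullet> (q - a) + (F q - F p) \<bullet> (w - q)"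
    by (simp add: inner_simps algebra_simps)
  have split': "((q - w) - U (q - w) - U t - (2 *\<^sub>R F q - F p) + F a) \<bullet> (w - a) =
      ((q - w) - U (q - w)) \<bullet> (w - a) - U t \<bullet> (w - a) - (2 *\<^sub>R F q - F p - F a) \<bullet> (w - a)"
    by (simp add: inner_simps algebra_simps)
  have "lyapunov a r (k+1) = (w - a) \<bullet> ((w - a) - U (w - a)) + t \<bullet> U t
      - 2 * ((F w - F q) \<bullet> (w - a)) + M * (norm (w - q))\<^sup>2"
    by (simp add: lyapunov_def w_def q_def t_def)
  moreover have "lyapunov a r k = (q - a) \<bullet> ((q - a) - U (q - a)) + t0 \<bullet> U t0
      - 2 * ((F q - F p) \<bullet> (q - a)) + M * (norm (q - p))\<^sup>2"
    by (simp add: lyapunov_def p_def q_def t0_def)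
  moreover have "(\<sigma> - 2 * M) * (norm (w - q))\<^sup>2 = \<sigma> * (norm (w - q))\<^sup>2 - 2 * (M * (norm (w - q))\<^sup>2)"
    by (simp add: algebra_simps)
  moreover note coercive[of "w - q"] F_cross_bound[of q p "w - q"] F_monotone[of w a]
    mono metric dual split split'
  ultimately show ?thesis unfolding w_def[symmetric] q_def[symmetric]
    by linarith
qed

text \<open>By \<open>F_cross_bound\<close> the inner product in \<open>lyapunov\<close> is paid for by the squared increment in the
  last term and by \<open>M\<close> times the squared distance, which the metric absorbs.\<close>

lemma lyapunov_lower_bound:
  "(\<sigma> - M) * (norm (z (k+1) - a))\<^sup>2 + (s (k+1) - r) \<bullet> U (s (k+1) - r) \<le> lyapunov a r k"
  using coercive[of "z (k+1) - a"] F_cross_bound[of "z (k+1)" "z k" "z (k+1) - a"]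
  unfolding lyapunov_def left_diff_distrib by linarith

lemma lyapunov_decseq:
  assumes "kkt a r"
  shows "decseq (lyapunov a r)"
proof (rule decseq_SucI)
  fix k
  have "0 \<le> (\<sigma> - 2 * M) * (norm (z (k+2) - z (k+1)))\<^sup>2" using M_small by simp
  then show "lyapunov a r (Suc k) \<le> lyapunov a r k"
    using lyapunov_decrease[OF assms, of k] nonneg[of "z (k+2)"] unfolding Suc_eq_plus1 by linarith
qed

lemma lyapunov_converges:
  assumes "kkt a r"
  obtains l where "lyapunov a r \<longlonglongrightarrow> l"
proof -
  have "\<forall>k. 0 \<le> lyapunov a r k"
  proof
    fix k
    have "0 \<le> (\<sigma> - M) * (norm (z (k+1) - a))\<^sup>2" using M_nonneg M_small by simp
    then show "0 \<le> lyapunov a r k"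
      using lyapunov_lower_bound[of k a r] nonneg[of "s (k+1) - r"] by linarith
  qed
  from decseq_convergent[OF lyapunov_decseq[OF assms] this] show thesis using that by blast
qed

lemma increments_vanish:
  assumes "kkt a r"
  shows "(\<lambda>k. z (k+1) - z k) \<longlonglongrightarrow> 0" and "(\<lambda>k. U (z k)) \<longlonglongrightarrow> 0"
proof -
  define \<delta> where "\<delta> k = lyapunov a r k - lyapunov a r (k+1)" for k
  obtain l where "lyapunov a r \<longlonglongrightarrow> l" using lyapunov_converges[OF assms] by blast
  then have "\<delta> \<longlonglongrightarrow> l - l"
    unfolding \<delta>_def using LIMSEQ_ignore_initial_segment[of _ l 1] by (intro tendsto_diff) auto
  then have \<delta>: "\<delta> \<longlonglongrightarrow> 0" by simp
  have c: "\<sigma> - 2 * M > 0" using M_small by simp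
  have le: "(\<sigma> - 2 * M) * (norm (z (k+2) - z (k+1)))\<^sup>2 + z (k+2) \<bullet> U (z (k+2)) \<le> \<delta> k" for k
    using lyapunov_decrease[OF assms, of k] by (simp add: \<delta>_def)
  have "(norm (z (k+2) - z (k+1)))\<^sup>2 \<le> (1 / (\<sigma> - 2 * M)) * \<delta> k" for k
    using le[of k] nonneg[of "z (k+2)"] c by (simp add: field_simps)
  then have "(\<lambda>k. z (k+2) - z (k+1)) \<longlonglongrightarrow> 0"
    using \<delta> by (rule tendsto_zero_if_norm_square_le)
  then show "(\<lambda>k. z (k+1) - z k) \<longlonglongrightarrow> 0"
    using LIMSEQ_offset[of "\<lambda>k. z (k+1) - z k" 1 0] by simp
  obtain C where C: "C > 0" "\<And>a. (norm (U a))\<^sup>2 \<le> C * (a \<bullet> U a)" using norm_le_form by blast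
  have "(norm (U (z (k+2))))\<^sup>2 \<le> C * \<delta> k" for k
  proof -
    have "z (k+2) \<bullet> U (z (k+2)) \<le> \<delta> k"
    proof -
      have "0 \<le> (\<sigma> - 2 * M) * (norm (z (k+2) - z (k+1)))\<^sup>2" using c by simp
      then show ?thesis using le[of k] by linarith
    qed
    then show ?thesis using order_trans[OF C(2) mult_left_mono[OF _ less_imp_le[OF C(1)]]] by blast
  qed
  then have "(\<lambda>k. U (z (k+2))) \<longlonglongrightarrow> 0"
    using \<delta> by (rule tendsto_zero_if_norm_square_le)
  then show "(\<lambda>k. U (z k)) \<longlonglongrightarrow> 0" by (rule LIMSEQ_offset)
qed

lemma iterates_bounded:
  assumes "kkt a r"
  shows "bounded (range (\<lambda>k. (z (k+1), U (s (k+1)))))"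
proof -
  define B where "B = lyapunov a r 0"
  have B: "lyapunov a r k \<le> B" for k
    using decseqD[OF lyapunov_decseq[OF assms], of 0 k] by (simp add: B_def)
  have c: "\<sigma> - M > 0" using M_nonneg M_small by simp
  obtain C where C: "C > 0" "\<And>a. (norm (U a))\<^sup>2 \<le> C * (a \<bullet> U a)" using norm_le_form by blast
  have z: "norm (z (k+1) - a) \<le> sqrt (B / (\<sigma> - M))" for k
  proof (rule real_le_rsqrt)
    have "(\<sigma> - M) * (norm (z (k+1) - a))\<^sup>2 \<le> B"
      using lyapunov_lower_bound[of k a r] nonneg[of "s (k+1) - r"] B[of k] by simp
    then show "(norm (z (k+1) - a))\<^sup>2 \<le> B / (\<sigma> - M)" using c by (simp add: field_simps)
  qed
  have s: "norm (U (s (k+1)) - U r) \<le> sqrt (C * B)" for k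
  proof (rule real_le_rsqrt)
    have "0 \<le> (\<sigma> - M) * (norm (z (k+1) - a))\<^sup>2" using c by simp
    then have "(s (k+1) - r) \<bullet> U (s (k+1) - r) \<le> B"
      using lyapunov_lower_bound[of k a r] B[of k] by simp
    then have "(norm (U (s (k+1) - r)))\<^sup>2 \<le> C * B"
      by (rule order_trans[OF C(2) mult_left_mono[OF _ less_imp_le[OF C(1)]]])
    then show "(norm (U (s (k+1)) - U r))\<^sup>2 \<le> C * B" by (simp add: linear_diff[OF linear])
  qed
  have "norm (z (k+1), U (s (k+1))) \<le> (sqrt (B / (\<sigma> - M)) + norm a) + (sqrt (C * B) + norm (U r))" for k
  proof -
    have "norm (z (k+1), U (s (k+1))) \<le> norm (z (k+1)) + norm (U (s (k+1)))" by (rule norm_Pair_le)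
    moreover have "norm (z (k+1)) \<le> norm (z (k+1) - a) + norm a" by norm
    moreover have "norm (U (s (k+1))) \<le> norm (U (s (k+1)) - U r) + norm (U r)" by norm
    ultimately show ?thesis using z[of k] s[of k] by linarith
  qed
  then show ?thesis unfolding bounded_iff by blast
qed

text \<open>Opial's argument. A cluster point is again a solution, since \<open>T\<close> has a closed graph and the
  increments vanish. The Lyapunov sequence of that very solution converges, and along the
  subsequence it tends to \<open>0\<close>, so it tends to \<open>0\<close> altogether and forces convergence of \<open>z\<close>.\<close>

lemma converges_to_kkt:
  assumes "kkt a0 r0"
  obtains a r where "kkt a r" "z \<longlonglongrightarrow> a"
proof -
  obtain \<rho> l where \<rho>: "strict_mono \<rho>" "((\<lambda>k. (z (k+1), U (s (k+1)))) \<circ> \<rho>) \<longlonglongrightarrow> l"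
    using bounded_imp_convergent_subsequence[OF iterates_bounded[OF assms]] by blast
  obtain a w where l: "l = (a, w)" by (cases l)
  have z1: "(\<lambda>j. z (\<rho> j + 1)) \<longlonglongrightarrow> a" and Us1: "(\<lambda>j. U (s (\<rho> j + 1))) \<longlonglongrightarrow> w"
    using tendsto_fst[OF \<rho>(2)] tendsto_snd[OF \<rho>(2)] by (simp_all add: o_def l)
  \<comment> \<open>only \<open>U s\<close> is known to be bounded, so a multiplier has to be recovered from its limit\<close>
  have "closed (range U)"
    using linear_subspace_image[OF linear subspace_UNIV] by (rule closed_subspace)
  then have "w \<in> range U" using Us1 by (intro closed_sequentially[of "range U" "\<lambda>j. U (s (\<rho> j + 1))" w]) auto
  then obtain r where r: "w = U r" by blast
  note sub = LIMSEQ_subseq_LIMSEQ[OF _ \<rho>(1), unfolded o_def]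
  have d1: "(\<lambda>j. z (\<rho> j + 1) - z (\<rho> j)) \<longlonglongrightarrow> 0"
    using sub[OF increments_vanish(1)[OF assms]] .
  have d2: "(\<lambda>j. z (\<rho> j + 2) - z (\<rho> j + 1)) \<longlonglongrightarrow> 0"
    using sub[OF LIMSEQ_ignore_initial_segment[OF increments_vanish(1)[OF assms], of 1]] by simp
  have z0: "(\<lambda>j. z (\<rho> j)) \<longlonglongrightarrow> a" using tendsto_diff[OF z1 d1] by simp
  have z2: "(\<lambda>j. z (\<rho> j + 2)) \<longlonglongrightarrow> a" using tendsto_add[OF z1 d2] by simp
  have contU: "isCont U b" for b using linear by (simp add: linear_continuous_at linear_conv_bounded_linear)
  have Uz: "(\<lambda>j. U (z (\<rho> j + 2))) \<longlonglongrightarrow> 0"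
    using sub[OF LIMSEQ_ignore_initial_segment[OF increments_vanish(2)[OF assms], of 2]] .
  have "(\<lambda>j. U (z (\<rho> j + 2))) \<longlonglongrightarrow> U a" using contU z2 by (rule isCont_tendsto_compose)
  then have Ua: "U a = 0" using Uz LIMSEQ_unique by blast
  have Us2: "(\<lambda>j. U (s (\<rho> j + 2))) \<longlonglongrightarrow> U r"
    using tendsto_add[OF Us1 Uz] unfolding dual_step by (simp add: linear_add[OF linear] r)
  have F_lim: "(\<lambda>j. F (b j)) \<longlonglongrightarrow> F a" if "b \<longlonglongrightarrow> a" for b :: "nat \<Rightarrow> 'a"
  proof -
    have "M-lipschitz_on UNIV F"
      using F_lipschitz M_nonneg by (intro lipschitz_onI) (auto simp: dist_norm)
    then have "isCont F a"
      using lipschitz_on_continuous_on continuous_on_eq_continuous_at open_UNIV by blast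
    then show ?thesis using that by (rule isCont_tendsto_compose)
  qed
  have Ud2: "(\<lambda>j. U (z (\<rho> j + 1) - z (\<rho> j + 2))) \<longlonglongrightarrow> U (a - a)"
    by (intro isCont_tendsto_compose[OF contU] tendsto_diff z1 z2)
  have "(\<lambda>j. (z (\<rho> j + 1) - z (\<rho> j + 2)) - U (z (\<rho> j + 1) - z (\<rho> j + 2)) - U (s (\<rho> j + 2))
        - (2 *\<^sub>R F (z (\<rho> j + 1)) - F (z (\<rho> j)))) \<longlonglongrightarrow> (a - a) - U (a - a) - U r - (2 *\<^sub>R F a - F a)"
    by (intro tendsto_intros z1 z2 Ud2 Us2 F_lim z0)
  then have "(a - a) - U (a - a) - U r - (2 *\<^sub>R F a - F a) \<in> T a"
    by (rule T_closed[OF step z2])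
  then have kkt: "kkt a r" using Ua by (simp add: kkt_def scaleR_2 linear_0[OF linear])
  have "(\<lambda>j. lyapunov a r (\<rho> j)) \<longlonglongrightarrow> 0"
  proof -
    have za: "(\<lambda>j. z (\<rho> j + 1) - a) \<longlonglongrightarrow> 0" using z1 by (simp add: LIM_zero)
    have "(\<lambda>j. U (z (\<rho> j + 1) - a)) \<longlonglongrightarrow> U 0" using contU za by (rule isCont_tendsto_compose)
    then have Uza: "(\<lambda>j. U (z (\<rho> j + 1) - a)) \<longlonglongrightarrow> 0" by (simp add: linear_0[OF linear])
    obtain C where C: "\<And>t. t \<bullet> U t \<le> C * (norm (U t))\<^sup>2" using form_le_norm by blast
    have "(\<lambda>j. U (s (\<rho> j + 1) - r)) \<longlonglongrightarrow> 0"
      using Us1 r by (simp add: linear_diff[OF linear] LIM_zero)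
    then have "(\<lambda>j. C * (norm (U (s (\<rho> j + 1) - r)))\<^sup>2) \<longlonglongrightarrow> C * (norm (0::'a))\<^sup>2"
      by (intro tendsto_intros)
    then have lim: "(\<lambda>j. C * (norm (U (s (\<rho> j + 1) - r)))\<^sup>2) \<longlonglongrightarrow> 0" by simp
    have sr: "(\<lambda>j. (s (\<rho> j + 1) - r) \<bullet> U (s (\<rho> j + 1) - r)) \<longlonglongrightarrow> 0"
      by (rule tendsto_sandwich[OF _ _ tendsto_const lim]) (simp_all add: nonneg C)
    have "(\<lambda>j. lyapunov a r (\<rho> j)) \<longlonglongrightarrow>
        (0::'a) \<bullet> (0 - 0) + 0 - 2 * ((F a - F a) \<bullet> 0) + M * (norm (0::'a))\<^sup>2"
      unfolding lyapunov_def
      by (intro tendsto_add tendsto_diff tendsto_mult tendsto_const tendsto_power tendsto_norm sr d1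
          tendsto_inner[OF za tendsto_diff[OF za Uza]]
          tendsto_inner[OF tendsto_diff[OF F_lim[OF z1] F_lim[OF z0]] za])
    then show ?thesis by simp
  qed
  moreover obtain m where m: "lyapunov a r \<longlonglongrightarrow> m"
    using lyapunov_converges[OF kkt] by blast
  ultimately have "m = 0" using sub[OF m] LIMSEQ_unique by blast
  have c: "\<sigma> - M > 0" using M_nonneg M_small by simp
  have "(norm (z (k+1) - a))\<^sup>2 \<le> (1 / (\<sigma> - M)) * lyapunov a r k" for k
    using lyapunov_lower_bound[of k a r] nonneg[of "s (k+1) - r"] c by (simp add: field_simps)
  then have "(\<lambda>k. z (k+1) - a) \<longlonglongrightarrow> 0"
    using m unfolding \<open>m = 0\<close> by (rule tendsto_zero_if_norm_square_le)
  then have "(\<lambda>k. z (k+1)) \<longlonglongrightarrow> a" by (simp add: LIM_zero_iff)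
  then have "z \<longlonglongrightarrow> a" by (rule LIMSEQ_offset)
  with kkt show thesis by (rule that)
qed

end

section \<open>Mixing matrices acting on stacked vectors\<close>

text \<open>The minimum \<open>m\<close> of the quadratic form on the unit sphere is attained at some \<open>v\<close>. The form of
  \<open>W - m Id\<close> is then nonnegative and vanishes at \<open>v\<close>, which forces \<open>W v = m v\<close>.\<close>

lemma lambda_min_le_form:
  fixes W :: "real^'n^'n"
  assumes sym: "W = transpose W"
  shows "lambda_min W * (norm a)\<^sup>2 \<le> a \<bullet> (W *v a)"
proof -
  have Wsym: "(W *v a) \<bullet> b = a \<bullet> (W *v b)" for a b
    by (metis dot_lmul_matrix inner_commute sym transpose_matrix_vector)
  let ?S = "sphere (0::real^'n) 1"
  have "?S \<noteq> {}" by simp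
  moreover have "continuous_on ?S (\<lambda>a. a \<bullet> (W *v a))"
    by (intro continuous_intros linear_continuous_on matrix_vector_mul_bounded_linear)
  ultimately obtain v where v: "v \<in> ?S" "\<And>a. a \<in> ?S \<Longrightarrow> v \<bullet> (W *v v) \<le> a \<bullet> (W *v a)"
    using continuous_attains_inf[OF compact_sphere, of 0 1 "\<lambda>a. a \<bullet> (W *v a)"] by blast
  define m where "m = v \<bullet> (W *v v)"
  have form: "m * (norm a)\<^sup>2 \<le> a \<bullet> (W *v a)" for a
  proof (cases "a = 0")
    case False
    have "m \<le> (a /\<^sub>R norm a) \<bullet> (W *v (a /\<^sub>R norm a))"
      unfolding m_def using False by (intro v(2)) simp
    then show ?thesis
      using False by (simp add: matrix_vector_mult_scaleR field_simps power2_eq_square)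
  qed simp
  interpret P: psd_operator "\<lambda>a. W *v a - m *\<^sub>R a"
  proof (rule psd_operator.intro)
    show "linear (\<lambda>a. W *v a - m *\<^sub>R a)"
      by (intro linear_compose_sub matrix_vector_mul_linear linear_compose_scale_right linear_id[unfolded id_def])
    show "(W *v a - m *\<^sub>R a) \<bullet> b = a \<bullet> (W *v b - m *\<^sub>R b)" for a b
      by (simp add: inner_simps Wsym)
    show "0 \<le> a \<bullet> (W *v a - m *\<^sub>R a)" for a
      using form[of a] by (simp add: inner_simps power2_norm_eq_inner)
  qed
  have "v \<bullet> (W *v v - m *\<^sub>R v) = 0"
    using v(1) by (simp add: inner_simps m_def norm_eq_1)
  then have "(norm (W *v v - m *\<^sub>R v))\<^sup>2 \<le> 0" using P.norm_le_form by (metis mult_zero_right)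
  then have "W *v v = m *\<^sub>R v" by simp
  then have "is_eigenvalue W m" using v(1) unfolding is_eigenvalue_def by (intro exI[of _ v]) auto
  moreover have "m \<le> l" if l: "is_eigenvalue W l" for l
  proof -
    obtain u where u: "u \<noteq> 0" "W *v u = l *\<^sub>R u" using l unfolding is_eigenvalue_def by blast
    have "m * (norm u)\<^sup>2 \<le> l * (norm u)\<^sup>2" using form[of u] u(2) by (simp add: dot_square_norm)
    then show ?thesis using u(1) by simp
  qed
  ultimately have "lambda_min W = m" unfolding lambda_min_def by (rule Least_equality)
  with form show ?thesis by simp
qed

text \<open>A matrix acts on a stacked vector columnwise, so its quadratic form there is the sum of the
  forms of the columns.\<close>

lemma column_matrix_mult: "column c (A ** x) = A *v column c x"
  by (simp add: vec_eq_iff column_def matrix_matrix_mult_def matrix_vector_mult_def)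

lemma inner_eq_sum_columns:
  fixes x y :: "real^'p^'n"
  shows "x \<bullet> y = (\<Sum>c\<in>UNIV. column c x \<bullet> column c y)"
  unfolding inner_vec_def column_def by (simp add: inner_vec_def) (rule sum.swap)

lemma stacked_eq_0_iff_columns:
  fixes x :: "real^'p^'n"
  shows "x = 0 \<longleftrightarrow> (\<forall>c. column c x = 0)"
  by (auto simp: vec_eq_iff column_def)

lemma column_diff: "column c (x - y) = column c x - column c y"
  by (simp add: vec_eq_iff column_def)

text \<open>The factor \<open>1/2\<close> makes identity minus \<open>disagreement W\<close> equal to \<open>(Id + W) / 2\<close>, which is positive
  definite and serves as the metric of the iteration, while the kernel still is the set of stacked
  vectors with equal rows.\<close>

definition disagreement :: "real^'n^'n \<Rightarrow> real^'p^'n \<Rightarrow> real^'p^'n" where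
  "disagreement W x = (1/2) *\<^sub>R (x - W ** x)"

lemma linear_matrix_mult_left: "linear (\<lambda>x::real^'p^'n. (A::real^'n^'m) ** x)"
  by (rule linearI)
    (simp_all add: matrix_matrix_mult_def vec_eq_iff sum_distrib_left distrib_left sum.distrib
      mult.left_commute)

lemma linear_disagreement: "linear (disagreement W :: real^'p^'n \<Rightarrow> real^'p^'n)"
  unfolding disagreement_def[abs_def]
  by (intro linear_compose_scale_right linear_compose_sub linear_matrix_mult_left linear_id[unfolded id_def])

lemma disagreement_psd:
  fixes W :: "real^'n^'n"
  assumes "mixing_matrix E W"
  shows "psd_operator (disagreement W :: real^'p^'n \<Rightarrow> real^'p^'n)"
proof (rule psd_operator.intro)
  have sym: "W = transpose W" and psd: "\<And>a. 0 \<le> a \<bullet> ((mat 1 - W) *v a)"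
    using assms unfolding mixing_matrix_def by blast+
  have Wsym: "(W *v a) \<bullet> b = a \<bullet> (W *v b)" for a b
    by (metis dot_lmul_matrix inner_commute sym transpose_matrix_vector)
  show "linear (disagreement W :: real^'p^'n \<Rightarrow> real^'p^'n)" by (rule linear_disagreement)
  show "disagreement W a \<bullet> b = a \<bullet> disagreement W b" for a b :: "real^'p^'n"
    by (simp add: disagreement_def inner_simps inner_eq_sum_columns[of "W ** a"]
        inner_eq_sum_columns[of a "W ** b"] column_matrix_mult Wsym)
  show "0 \<le> a \<bullet> disagreement W a" for a :: "real^'p^'n"
  proof -
    have "0 \<le> (\<Sum>c\<in>UNIV. column c a \<bullet> ((mat 1 - W) *v column c a))" by (intro sum_nonneg psd)
    also have "\<dots> = a \<bullet> (a - W ** a)"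
      by (simp add: inner_eq_sum_columns[of a] column_diff column_matrix_mult
          matrix_vector_mult_diff_rdistrib)
    finally show ?thesis by (simp add: disagreement_def)
  qed
qed

lemma disagreement_eq_0_iff:
  fixes W :: "real^'n^'n" and x :: "real^'p^'n"
  assumes "mixing_matrix E W"
  shows "disagreement W x = 0 \<longleftrightarrow> (\<forall>i j. x $ i = x $ j)"
proof -
  have ker: "(mat 1 - W) *v a = 0 \<longleftrightarrow> (\<forall>i j. a $ i = a $ j)" for a
    using assms unfolding mixing_matrix_def by blast
  have "disagreement W x = 0 \<longleftrightarrow> (\<forall>c. (mat 1 - W) *v column c x = 0)"
    by (simp add: disagreement_def stacked_eq_0_iff_columns[of "x - W ** x"] column_diff
        column_matrix_mult matrix_vector_mult_diff_rdistrib del: eq_iff_diff_eq_0 right_minus_eq)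
  also have "\<dots> \<longleftrightarrow> (\<forall>i j. x $ i = x $ j)"
    unfolding ker by (auto simp: column_def vec_eq_iff)
  finally show ?thesis .
qed

text \<open>This is where the smallest eigenvalue, and with it the bound on the steplength, comes from.\<close>

lemma disagreement_coercive:
  fixes W :: "real^'n^'n" and x :: "real^'p^'n"
  assumes "mixing_matrix E W"
  shows "(1 + lambda_min W) / 2 * (norm x)\<^sup>2 \<le> x \<bullet> (x - disagreement W x)"
proof -
  have sym: "W = transpose W" using assms unfolding mixing_matrix_def by blast
  have "lambda_min W * (norm x)\<^sup>2 = (\<Sum>c\<in>UNIV. lambda_min W * (norm (column c x))\<^sup>2)"
    by (simp add: power2_norm_eq_inner inner_eq_sum_columns[of x] sum_distrib_left)
  also have "\<dots> \<le> (\<Sum>c\<in>UNIV. column c x \<bullet> (W *v column c x))"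
    by (intro sum_mono lambda_min_le_form sym)
  also have "\<dots> = x \<bullet> (W ** x)" by (simp add: inner_eq_sum_columns[of x] column_matrix_mult)
  finally show ?thesis
    by (simp add: disagreement_def inner_simps power2_norm_eq_inner field_simps)
qed

lemma inner_const_rows: "v \<bullet> (\<chi> i. a) = (\<Sum>i\<in>UNIV. v $ i) \<bullet> (a::real^'p)"
  by (simp add: inner_vec_def[of v] inner_sum_left)

text \<open>The kernel consists of the stacked vectors with equal rows, whose orthogonal complement
  consists of those with row sum \<open>0\<close>.\<close>

lemma zero_row_sum_in_range_disagreement:
  fixes W :: "real^'n^'n" and v :: "real^'p^'n"
  assumes "mixing_matrix E W" "(\<Sum>i\<in>UNIV. v $ i) = 0"
  shows "v \<in> range (disagreement W)"
proof (rule psd_operator.orthogonal_kernel_imp_in_range[OF disagreement_psd[OF assms(1)]])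
  fix b :: "real^'p^'n" assume "disagreement W b = 0"
  then have "\<And>i j. b $ i = b $ j" using disagreement_eq_0_iff[OF assms(1)] by blast
  then have "b = (\<chi> i. b $ undefined)" by (simp add: vec_eq_iff)
  then show "v \<bullet> b = 0" using inner_const_rows[of v "b $ undefined"] assms(2) by simp
qed

lemma row_sum_disagreement:
  fixes W :: "real^'n^'n" and x :: "real^'p^'n"
  assumes "mixing_matrix E W"
  shows "(\<Sum>i\<in>UNIV. disagreement W x $ i) = 0"
proof -
  interpret psd_operator "disagreement W :: real^'p^'n \<Rightarrow> _" by (rule disagreement_psd[OF assms])
  have "(\<Sum>i\<in>UNIV. disagreement W x $ i) \<bullet> a = x \<bullet> disagreement W (\<chi> i. a)" for a
    using symmetric[of x "\<chi> i. a"] by (simp add: inner_const_rows)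
  moreover have "disagreement W (\<chi> i. a) = 0" for a :: "real^'p"
    unfolding disagreement_eq_0_iff[OF assms] by simp
  ultimately show ?thesis by (metis inner_zero_right inner_eq_zero_iff)
qed

text \<open>Summing the recursion telescopes it. The mixing terms that remain accumulate in
  \<open>\<Sum>j=1..k. x j - x 0\<close>, which acts as the multiplier of the constraint that all rows agree.\<close>

lemma mixing_recursion_closed_form:
  fixes x v u :: "nat \<Rightarrow> real^'p^'n"
  assumes u1: "u 1 = x 0 - \<tau> *\<^sub>R v 0"
    and rec: "\<And>k. k \<ge> 1 \<Longrightarrow> u (k + 1) = W ** x k + u k
        - ((1/2) *\<^sub>R (mat 1 + W)) ** x (k - 1) - \<tau> *\<^sub>R (v k - v (k - 1))"
  shows "u (k + 1) = x k - disagreement W (x k) - disagreement W ((\<Sum>j=1..k. x j) - x 0) - \<tau> *\<^sub>R v k"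
proof -
  have half: "((1/2) *\<^sub>R (mat 1 + W)) ** a = a - disagreement W a" for a :: "real^'p^'n"
  proof -
    have "((1/2) *\<^sub>R (mat 1 + W)) ** a = (1/2) *\<^sub>R ((mat 1 + W) ** a)"
      by (simp add: matrix_matrix_mult_def vec_eq_iff sum_distrib_left mult.assoc)
    also have "\<dots> = (1/2) *\<^sub>R (a + W ** a)"
      by (simp add: matrix_matrix_mult_def vec_eq_iff distrib_right sum.distrib)
        (simp add: mat_def if_distrib[of "\<lambda>t. t * _"] cong: if_cong)
    also have "\<dots> = a - disagreement W a" by (simp add: disagreement_def vec_eq_iff field_simps)
    finally show ?thesis .
  qed
  have W: "W ** a = a - disagreement W a - disagreement W a" for a :: "real^'p^'n"
    by (simp add: disagreement_def vec_eq_iff field_simps)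
  note lin = linear_disagreement[of W]
  show ?thesis
  proof (induction k)
    case 0
    show ?case using u1 by (simp add: linear_neg[OF lin])
  next
    case (Suc k)
    have "u (Suc k + 1) = W ** x (Suc k) + u (k + 1) - (x k - disagreement W (x k))
        - \<tau> *\<^sub>R (v (Suc k) - v k)"
      using rec[of "Suc k"] by (simp add: half)
    then show ?case
      unfolding Suc.IH W by (simp add: linear_add[OF lin] linear_diff[OF lin] scaleR_diff_right)
  qed
qed

text \<open>The same in residual form, with the multiplier advanced by one step: this is what the implicit
  step of the primal-dual iteration requires.\<close>

lemma mixing_recursion_residual:
  fixes x v u :: "nat \<Rightarrow> real^'p^'n"
  assumes u1: "u 1 = x 0 - \<tau> *\<^sub>R v 0"
    and rec: "\<And>k. k \<ge> 1 \<Longrightarrow> u (k + 1) = W ** x k + u k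
        - ((1/2) *\<^sub>R (mat 1 + W)) ** x (k - 1) - \<tau> *\<^sub>R (v k - v (k - 1))"
  shows "(x (k+1) - x (k+2)) - disagreement W (x (k+1) - x (k+2))
      - disagreement W ((\<Sum>j=1..k+2. x j) - x 0) - \<tau> *\<^sub>R v (k+1) = u (k+2) - x (k+2)"
proof -
  have "u (k+1+1) = x (k+1) - disagreement W (x (k+1))
      - disagreement W ((\<Sum>j=1..k+1. x j) - x 0) - \<tau> *\<^sub>R v (k+1)"
    by (rule mixing_recursion_closed_form[where u = u and x = x and v = v, OF u1 rec])
  moreover have "(\<Sum>j=1..k+2. x j) - x 0 = ((\<Sum>j=1..k+1. x j) - x 0) + x (k+2)" by simp
  ultimately show ?thesis
    by (simp add: linear_add[OF linear_disagreement] linear_diff[OF linear_disagreement])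
qed

section \<open>The saddle operator of the stacked coupling\<close>

lemma GDERIV_partial_fst:
  assumes "GDERIV \<psi> (a, b) :> D"
  shows "GDERIV (\<lambda>a'. \<psi> (a', b)) a :> fst D"
proof -
  have "((\<lambda>a'. (a', b)) has_derivative (\<lambda>h. (h, 0))) (at a)"
    by (intro has_derivative_Pair has_derivative_ident has_derivative_const)
  from has_derivative_compose[OF this, of \<psi> "\<lambda>h. h \<bullet> D"] assms show ?thesis
    by (simp add: gderiv_def inner_prod_def)
qed

lemma GDERIV_partial_snd:
  assumes "GDERIV \<psi> (a, b) :> D"
  shows "GDERIV (\<lambda>b'. \<psi> (a, b')) b :> snd D"
proof -
  have "((\<lambda>b'. (a, b')) has_derivative (\<lambda>h. (0, h))) (at b)"
    by (intro has_derivative_Pair has_derivative_ident has_derivative_const)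
  from has_derivative_compose[OF this, of \<psi> "\<lambda>h. h \<bullet> D"] assms show ?thesis
    by (simp add: gderiv_def inner_prod_def)
qed

lemma GDERIV_sum:
  assumes "\<And>i. i \<in> I \<Longrightarrow> GDERIV (\<psi> i) a :> D i"
  shows "GDERIV (\<lambda>a. \<Sum>i\<in>I. \<psi> i a) a :> (\<Sum>i\<in>I. D i)"
  using assms unfolding gderiv_def inner_sum_right by (intro has_derivative_sum)

lemma GDERIV_sum_rows:
  fixes x :: "real^'p^'n"
  assumes "\<And>i. GDERIV (\<psi> i) (x $ i) :> D i"
  shows "GDERIV (\<lambda>x. \<Sum>i\<in>UNIV. \<psi> i (x $ i)) x :> (\<chi> i. D i)"
proof -
  have "((\<lambda>x. \<psi> i (x $ i)) has_derivative (\<lambda>h. h $ i \<bullet> D i)) (at x)" for i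
    using has_derivative_compose[OF bounded_linear_imp_has_derivative[OF bounded_linear_vec_nth[of i]],
        of "\<psi> i" "\<lambda>h. h \<bullet> D i" x UNIV] assms[of i]
    unfolding gderiv_def by simp
  then have "((\<lambda>x. \<Sum>i\<in>UNIV. \<psi> i (x $ i)) has_derivative (\<lambda>h. \<Sum>i\<in>UNIV. h $ i \<bullet> D i)) (at x)"
    by (intro has_derivative_sum)
  then show ?thesis unfolding gderiv_def by (simp add: inner_vec_def)
qed

lemma inner_eq_sum_rows:
  fixes x y :: "real^'p^'n"
  shows "x \<bullet> y = (\<Sum>i\<in>UNIV. x $ i \<bullet> y $ i)"
  by (rule inner_vec_def)

locale smooth_coupling =
  fixes \<phi> :: "'n::finite \<Rightarrow> (real^'p) \<times> (real^'d) \<Rightarrow> real" and L :: real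
  assumes differentiable: "\<And>i. \<phi> i differentiable_on UNIV"
    and convex_fst: "\<And>i b. convex_on UNIV (\<lambda>a. \<phi> i (a, b))"
    and concave_snd: "\<And>i a. concave_on UNIV (\<lambda>b. \<phi> i (a, b))"
    and lipschitz_gradient: "\<And>i. L-lipschitz_on UNIV (gradient (\<phi> i))"
begin

lemma GDERIV_coupling: "GDERIV (\<phi> i) c :> gradient (\<phi> i) c"
  using differentiable[of i] unfolding differentiable_on_def by (intro GDERIV_gradient) blast

lemma GDERIV_coupling_fst: "GDERIV (\<lambda>a. \<phi> i (a, b)) a :> fst (gradient (\<phi> i) (a, b))"
  by (rule GDERIV_partial_fst[OF GDERIV_coupling])

lemma GDERIV_coupling_snd: "GDERIV (\<lambda>b. \<phi> i (a, b)) b :> snd (gradient (\<phi> i) (a, b))"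
  by (rule GDERIV_partial_snd[OF GDERIV_coupling])

lemma grad_x_eq: "grad_x \<phi> x y = (\<chi> i. fst (gradient (\<phi> i) (x $ i, y $ i)))"
  unfolding grad_x_def stacked_coupling_def
  by (intro gradient_eqI GDERIV_sum_rows GDERIV_coupling_fst)

lemma grad_y_eq: "grad_y \<phi> x y = (\<chi> i. snd (gradient (\<phi> i) (x $ i, y $ i)))"
  unfolding grad_y_def stacked_coupling_def
  by (intro gradient_eqI GDERIV_sum_rows GDERIV_coupling_snd)

lemma coupling_above_tangent:
  "\<phi> i (a, b) + (a' - a) \<bullet> fst (gradient (\<phi> i) (a, b)) \<le> \<phi> i (a', b)"
  using convex_on_above_tangent_gradient[OF convex_fst GDERIV_coupling_fst] .

lemma coupling_below_tangent:
  "\<phi> i (a, b') \<le> \<phi> i (a, b) + (b' - b) \<bullet> snd (gradient (\<phi> i) (a, b))"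
proof -
  have "convex_on UNIV (\<lambda>b. - \<phi> i (a, b))" using concave_snd by (simp add: concave_on_def)
  moreover have "GDERIV (\<lambda>b. - \<phi> i (a, b)) b :> - snd (gradient (\<phi> i) (a, b))"
    by (rule GDERIV_minus[OF GDERIV_coupling_snd])
  ultimately have "- \<phi> i (a, b) + (b' - b) \<bullet> (- snd (gradient (\<phi> i) (a, b))) \<le> - \<phi> i (a, b')"
    by (rule convex_on_above_tangent_gradient)
  then show ?thesis by simp
qed

definition saddle_operator :: "(real^'p^'n) \<times> (real^'d^'n) \<Rightarrow> (real^'p^'n) \<times> (real^'d^'n)" where
  "saddle_operator z = (grad_x \<phi> (fst z) (snd z), - grad_y \<phi> (fst z) (snd z))"

text \<open>Add the four tangent inequalities along the sides of the rectangle with opposite corners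
  \<open>(a, b)\<close> and \<open>(a', b')\<close>: the values of \<open>\<phi> i\<close> at the corners cancel.\<close>

lemma saddle_operator_monotone:
  "0 \<le> (saddle_operator z - saddle_operator z') \<bullet> (z - z')"
proof -
  have row: "0 \<le> (fst (gradient (\<phi> i) (a, b)) - fst (gradient (\<phi> i) (a', b'))) \<bullet> (a - a')
      - (snd (gradient (\<phi> i) (a, b)) - snd (gradient (\<phi> i) (a', b'))) \<bullet> (b - b')" for i a b a' b'
    using coupling_above_tangent[of i a b a'] coupling_above_tangent[of i a' b' a]
      coupling_below_tangent[of i a b' b] coupling_below_tangent[of i a' b b']
    by (simp add: inner_diff_left inner_diff_right inner_commute)
  let ?D = "\<lambda>z i. gradient (\<phi> i) (fst z $ i, snd z $ i)"
  have "(saddle_operator z - saddle_operator z') \<bullet> (z - z') =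
      (\<Sum>i\<in>UNIV. (fst (?D z i) - fst (?D z' i)) \<bullet> (fst z $ i - fst z' $ i)
        - (snd (?D z i) - snd (?D z' i)) \<bullet> (snd z $ i - snd z' $ i))"
    by (simp add: saddle_operator_def grad_x_eq grad_y_eq inner_prod_def inner_eq_sum_rows
        sum.distrib sum_subtractf inner_diff_left inner_diff_right)
  also have "0 \<le> \<dots>" by (intro sum_nonneg row)
  finally show ?thesis .
qed

lemma norm_stacked_pair:
  fixes z :: "(real^'p^'n) \<times> (real^'d^'n)"
  shows "(norm z)\<^sup>2 = (\<Sum>i\<in>UNIV. (norm (fst z $ i, snd z $ i))\<^sup>2)"
  by (simp add: power2_norm_eq_inner inner_prod_def inner_vec_def sum.distrib)

lemma saddle_operator_lipschitz:
  "norm (saddle_operator z - saddle_operator z') \<le> L * norm (z - z')"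
proof (rule power2_le_imp_le)
  have L: "0 \<le> L" using lipschitz_on_nonneg[OF lipschitz_gradient] .
  let ?D = "\<lambda>z i. gradient (\<phi> i) (fst z $ i, snd z $ i)"
  have row: "(norm (?D z i - ?D z' i))\<^sup>2 \<le> L\<^sup>2 * (norm (fst (z - z') $ i, snd (z - z') $ i))\<^sup>2" for i
  proof -
    have "norm (?D z i - ?D z' i) \<le> L * norm (fst (z - z') $ i, snd (z - z') $ i)"
      using lipschitz_onD[OF lipschitz_gradient[of i], of "(fst z $ i, snd z $ i)" "(fst z' $ i, snd z' $ i)"]
      by (simp add: dist_norm)
    from power_mono[OF this, of 2] show ?thesis by (simp add: power_mult_distrib)
  qed
  have "(norm (saddle_operator z - saddle_operator z'))\<^sup>2 = (\<Sum>i\<in>UNIV. (norm (?D z i - ?D z' i))\<^sup>2)"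
    unfolding norm_stacked_pair
    by (intro sum.cong refl)
      (simp add: power2_norm_eq_inner saddle_operator_def grad_x_eq grad_y_eq inner_prod_def
        inner_diff_left inner_diff_right)
  also have "\<dots> \<le> (\<Sum>i\<in>UNIV. L\<^sup>2 * (norm (fst (z - z') $ i, snd (z - z') $ i))\<^sup>2)"
    by (intro sum_mono row)
  also have "\<dots> = (L * norm (z - z'))\<^sup>2"
    by (simp add: norm_stacked_pair[of "z - z'"] sum_distrib_left[symmetric] power_mult_distrib)
  finally show "(norm (saddle_operator z - saddle_operator z'))\<^sup>2 \<le> (L * norm (z - z'))\<^sup>2" .
  show "0 \<le> L * norm (z - z')" using L by simp
qed

end

section \<open>Saddle-points as solutions of inclusions\<close>

lemma sum_uminus_ereal:
  fixes k :: "'i \<Rightarrow> ereal"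
  assumes "\<And>i. i \<in> I \<Longrightarrow> k i \<noteq> -\<infinity>"
  shows "(\<Sum>i\<in>I. - k i) = - (\<Sum>i\<in>I. k i)"
  using assms
proof (induction I rule: infinite_finite_induct)
  case (insert i I)
  moreover have "- a + - b = - (a + b)" if "a \<noteq> -\<infinity>" "b \<noteq> -\<infinity>" for a b :: ereal
    using that by (cases a; cases b) auto
  ultimately show ?case by (simp add: sum_ereal_neq_MInfty)
qed auto

text \<open>As soon as one of the two families is finite, no \<open>\<infinity> - \<infinity>\<close> can occur and the extended-valued
  part separates from the real part. In the next two lemmas the right-hand sides have the form that
  Fermat's rule treats, the second one after a change of sign.\<close>

lemma saddle_objective_finite_g:
  assumes "\<And>i. g i y = ereal (\<gamma> i)"
  shows "saddle_objective f \<phi> g x y = (\<Sum>i\<in>UNIV. f i x) + ereal (\<Sum>i\<in>UNIV. \<phi> i (x, y) - \<gamma> i)"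
proof -
  have "f i x + ereal (\<phi> i (x, y)) - g i y = f i x + ereal (\<phi> i (x, y) - \<gamma> i)" for i
    using assms[of i] by (cases "f i x") auto
  then show ?thesis by (simp add: saddle_objective_def sum.distrib)
qed

lemma saddle_objective_finite_f:
  assumes "\<And>i. f i x = ereal (\<alpha> i)" "\<And>i. g i y \<noteq> -\<infinity>"
  shows "saddle_objective f \<phi> g x y
    = - ((\<Sum>i\<in>UNIV. g i y) + ereal (\<Sum>i\<in>UNIV. - \<phi> i (x, y) - \<alpha> i))"
proof -
  have "f i x + ereal (\<phi> i (x, y)) - g i y = - (g i y + ereal (- \<phi> i (x, y) - \<alpha> i))" for i
    using assms(1)[of i] by (cases "g i y") auto
  then have "saddle_objective f \<phi> g x y = (\<Sum>i\<in>UNIV. - (g i y + ereal (- \<phi> i (x, y) - \<alpha> i)))"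
    by (simp add: saddle_objective_def)
  also have "\<dots> = - (\<Sum>i\<in>UNIV. g i y + ereal (- \<phi> i (x, y) - \<alpha> i))"
    using assms(2) by (intro sum_uminus_ereal) simp
  finally show ?thesis by (simp add: sum.distrib)
qed

lemma convex_on_sum_functions:
  assumes "convex S" "\<And>i. i \<in> I \<Longrightarrow> convex_on S (h i)"
  shows "convex_on S (\<lambda>x. \<Sum>i\<in>I. h i x)"
  using assms(2)
proof (induction I rule: infinite_finite_induct)
  case (insert i I)
  then show ?case by (simp add: convex_on_add)
qed (use assms(1) in \<open>simp_all add: convex_on_const\<close>)

text \<open>Fix the second argument at \<open>b\<close>, then the first one at \<open>a\<close>: each half of the saddle-point condition
  says that a convex function plus a smooth convex one is minimal, and Fermat's rule applies in
  both directions. If one of the sums is infinite, both sides fail.\<close>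

lemma (in smooth_coupling) saddle_point_iff:
  assumes f: "\<And>i x. f i x \<noteq> -\<infinity>" "\<And>i. ereal_convex (f i)"
    and g: "\<And>i y. g i y \<noteq> -\<infinity>" "\<And>i. ereal_convex (g i)"
  shows "saddle_point f \<phi> g a b \<longleftrightarrow>
      - (\<Sum>i\<in>UNIV. fst (gradient (\<phi> i) (a, b))) \<in> subdifferential (\<lambda>x. \<Sum>i\<in>UNIV. f i x) a \<and>
      (\<Sum>i\<in>UNIV. snd (gradient (\<phi> i) (a, b))) \<in> subdifferential (\<lambda>y. \<Sum>i\<in>UNIV. g i y) b"
    (is "_ \<longleftrightarrow> - ?Dx \<in> subdifferential ?f a \<and> ?Dy \<in> subdifferential ?g b")
proof -
  have sum_fin: "(\<Sum>i\<in>UNIV. h i) < \<infinity> \<longleftrightarrow> (\<forall>i. h i < \<infinity>)"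
    for h :: "'n \<Rightarrow> ereal"
    by (simp add: less_top[symmetric] sum_Pinfty top_ereal_def)
  have f_ninf: "?f x \<noteq> -\<infinity>" for x using f(1) by (intro sum_ereal_neq_MInfty)
  have g_ninf: "?g y \<noteq> -\<infinity>" for y using g(1) by (intro sum_ereal_neq_MInfty)
  show ?thesis
  proof (cases "?f a < \<infinity> \<and> ?g b < \<infinity>")
    case False
    then have "\<not> saddle_point f \<phi> g a b"
      unfolding saddle_point_def using sum_fin[of "\<lambda>i. f i a"] sum_fin[of "\<lambda>i. g i b"] f(1) g(1) by blast
    moreover have "\<not> (- ?Dx \<in> subdifferential ?f a \<and> ?Dy \<in> subdifferential ?g b)"
      using False by (meson subdifferential_finite)
    ultimately show ?thesis by blast
  next
    case True
    then have fa: "\<And>i. f i a < \<infinity>" and gb: "\<And>i. g i b < \<infinity>"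
      using sum_fin[of "\<lambda>i. f i a"] sum_fin[of "\<lambda>i. g i b"] f(1) g(1) by auto
    define \<alpha> \<gamma> where "\<alpha> i = real_of_ereal (f i a)" and "\<gamma> i = real_of_ereal (g i b)" for i
    have \<alpha>: "f i a = ereal (\<alpha> i)" for i
      unfolding \<alpha>_def using fa[of i] f(1)[of i a] by (cases "f i a") auto
    have \<gamma>: "g i b = ereal (\<gamma> i)" for i
      unfolding \<gamma>_def using gb[of i] g(1)[of i b] by (cases "g i b") auto
    let ?\<psi> = "\<lambda>x. \<Sum>i\<in>UNIV. \<phi> i (x, b) - \<gamma> i" and ?\<chi> = "\<lambda>y. \<Sum>i\<in>UNIV. - \<phi> i (a, y) - \<alpha> i"
    have d\<psi>: "GDERIV ?\<psi> a :> ?Dx"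
      using GDERIV_diff[OF GDERIV_coupling_fst GDERIV_const] by (intro GDERIV_sum) simp
    have d\<chi>: "GDERIV ?\<chi> b :> - ?Dy"
      using GDERIV_diff[OF GDERIV_minus[OF GDERIV_coupling_snd] GDERIV_const]
      unfolding sum_negf[symmetric] by (intro GDERIV_sum) simp
    have "convex_on UNIV (\<lambda>x. \<phi> i (x, b) - \<gamma> i)" for i
      using convex_on_add[OF convex_fst[of i b] convex_on_const[THEN iffD2, OF convex_UNIV, of "- \<gamma> i"]]
      by simp
    then have c\<psi>: "convex_on UNIV ?\<psi>" by (intro convex_on_sum_functions) auto
    have "convex_on UNIV (\<lambda>y. - \<phi> i (a, y) - \<alpha> i)" for i
      using convex_on_add[OF concave_snd[of i a, unfolded concave_on_def]
          convex_on_const[THEN iffD2, OF convex_UNIV, of "- \<alpha> i"]]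
      by simp
    then have c\<chi>: "convex_on UNIV ?\<chi>" by (intro convex_on_sum_functions) auto
    have min_x: "(\<forall>x. saddle_objective f \<phi> g a b \<le> saddle_objective f \<phi> g x b)
        \<longleftrightarrow> - ?Dx \<in> subdifferential ?f a"
      unfolding saddle_objective_finite_g[where f = f and \<phi> = \<phi> and g = g and y = b, OF \<gamma>]
      using minimizer_imp_neg_gradient_in_subdifferential[OF ereal_convex_sum f_ninf _ d\<psi>]
        neg_gradient_in_subdifferential_imp_minimizer[OF _ c\<psi> d\<psi> f_ninf] f True by auto
    have min_y: "(\<forall>y. saddle_objective f \<phi> g a y \<le> saddle_objective f \<phi> g a b)
        \<longleftrightarrow> - (- ?Dy) \<in> subdifferential ?g b"
      unfolding saddle_objective_finite_f[where f = f and \<phi> = \<phi> and g = g and x = a, OF \<alpha> g(1)]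
        ereal_minus_le_minus
      using minimizer_imp_neg_gradient_in_subdifferential[OF ereal_convex_sum g_ninf _ d\<chi>]
        neg_gradient_in_subdifferential_imp_minimizer[OF _ c\<chi> d\<chi> g_ninf] g True by auto
    show ?thesis
      unfolding saddle_point_def using fa gb min_x min_y by simp blast
  qed
qed

lemma stacked_sum_regular:
  assumes "\<And>i. proper (f i)" "\<And>i. lower_semicontinuous (f i)" "\<And>i. ereal_convex (f i)"
    and "\<tau> > 0"
  shows "lower_semicontinuous (\<lambda>x. ereal \<tau> * stacked_sum f x)"
    and "ereal_convex (\<lambda>x. ereal \<tau> * stacked_sum f x)"
    and "\<And>x. ereal \<tau> * stacked_sum f x \<noteq> -\<infinity>"
proof -
  have ninf: "f i x \<noteq> -\<infinity>" for i x using assms(1) by (simp add: proper_def)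
  then have ninf': "stacked_sum f x \<noteq> -\<infinity>" for x
    unfolding stacked_sum_def by (intro sum_ereal_neq_MInfty)
  have "lower_semicontinuous (\<lambda>x. f i (x $ i))" for i
    by (rule lower_semicontinuous_compose[OF assms(2)]) (intro continuous_intros)
  then have "lower_semicontinuous (stacked_sum f)"
    unfolding stacked_sum_def[abs_def] using ninf by (intro lower_semicontinuous_sum)
  then show "lower_semicontinuous (\<lambda>x. ereal \<tau> * stacked_sum f x)"
    using assms(4) by (rule lower_semicontinuous_scale)
  have "ereal_convex (\<lambda>x. f i (x $ i))" for i
    by (rule ereal_convex_compose_linear[OF assms(3) bounded_linear.linear[OF bounded_linear_vec_nth]])
  then have "ereal_convex (stacked_sum f)"
    unfolding stacked_sum_def[abs_def] using ninf by (intro ereal_convex_sum)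
  then show "ereal_convex (\<lambda>x. ereal \<tau> * stacked_sum f x)"
    using ninf' assms(4) by (rule ereal_convex_scale)
  show "ereal \<tau> * stacked_sum f x \<noteq> -\<infinity>" for x
    using ninf'[of x] assms(4) by (cases "stacked_sum f x") auto
qed

lemma stacked_subdifferentialI:
  fixes f :: "'n::finite \<Rightarrow> real^'p \<Rightarrow> ereal"
  assumes "\<And>i. v $ i \<in> subdifferential (f i) (x $ i)"
  shows "v \<in> subdifferential (stacked_sum f) x"
proof -
  have "f i (x $ i) \<noteq> \<infinity>" for i using subdifferential_finite[OF assms, of i] by simp
  then have fin: "stacked_sum f x < \<infinity>"
    unfolding stacked_sum_def by (simp add: less_top[symmetric] sum_Pinfty top_ereal_def)
  have "stacked_sum f x + ereal (v \<bullet> (w - x)) \<le> stacked_sum f w" for w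
  proof -
    have "stacked_sum f x + ereal (v \<bullet> (w - x))
        = (\<Sum>i\<in>UNIV. f i (x $ i) + ereal (v $ i \<bullet> (w $ i - x $ i)))"
      by (simp add: stacked_sum_def inner_vec_def sum.distrib)
    also have "\<dots> \<le> stacked_sum f w"
      unfolding stacked_sum_def by (intro sum_mono subdifferentialD assms)
    finally show ?thesis .
  qed
  with fin show ?thesis by (simp add: subdifferential_def)
qed

text \<open>It suffices to test the defining inequality with stacked vectors whose rows agree.\<close>

lemma row_sum_in_subdifferential_of_sum:
  fixes f :: "'n::finite \<Rightarrow> real^'p \<Rightarrow> ereal"
  assumes v: "v \<in> subdifferential (stacked_sum f) (\<chi> i. a)"
  shows "(\<Sum>i\<in>UNIV. v $ i) \<in> subdifferential (\<lambda>a. \<Sum>i\<in>UNIV. f i a) a"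
proof -
  have eq: "stacked_sum f (\<chi> i. w) = (\<Sum>i\<in>UNIV. f i w)" for w by (simp add: stacked_sum_def)
  have "(\<Sum>i\<in>UNIV. f i a) + ereal ((\<Sum>i\<in>UNIV. v $ i) \<bullet> (w - a)) \<le> (\<Sum>i\<in>UNIV. f i w)" for w
    using subdifferentialD[OF v, of "\<chi> i. w"] inner_const_rows[of v w] inner_const_rows[of v a]
    unfolding eq by (simp add: inner_diff_right)
  moreover have "(\<Sum>i\<in>UNIV. f i a) < \<infinity>" using subdifferential_finite[OF v] by (simp only: eq)
  ultimately show ?thesis by (simp add: subdifferential_def)
qed

text \<open>The sum rule distributes a subgradient of the sum over the summands. Stacked,
  these subgradients plus \<open>D\<close> have row sum \<open>0\<close>, hence lie in the range of \<open>disagreement W\<close>.\<close>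

lemma stacked_subgradient_exists:
  fixes f :: "'n::finite \<Rightarrow> real^'p \<Rightarrow> ereal" and W :: "real^'n^'n"
  assumes rule: "subdifferential (\<lambda>a. \<Sum>i\<in>UNIV. f i a) = (\<lambda>a. \<Sum>i\<in>UNIV. subdifferential (f i) a)"
    and v: "- (\<Sum>i\<in>UNIV. D $ i) \<in> subdifferential (\<lambda>a. \<Sum>i\<in>UNIV. f i a) a"
    and W: "mixing_matrix E W" and \<tau>: "\<tau> > 0"
  obtains r where
    "- disagreement W r - \<tau> *\<^sub>R D \<in> subdifferential (\<lambda>x. ereal \<tau> * stacked_sum f x) (\<chi> i. a)"
proof -
  have "- (\<Sum>i\<in>UNIV. D $ i) \<in> (\<Sum>i\<in>UNIV. subdifferential (f i) a)" using v by (simp only: rule)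
  then obtain \<xi> where \<xi>: "- (\<Sum>i\<in>UNIV. D $ i) = (\<Sum>i\<in>UNIV. \<xi> i)" "\<And>i. \<xi> i \<in> subdifferential (f i) a"
    unfolding set_sum_alt[OF finite] by auto
  define v where "v = (\<chi> i. \<xi> i)"
  have "v \<in> subdifferential (stacked_sum f) (\<chi> i. a)"
    using \<xi>(2) by (intro stacked_subdifferentialI) (simp add: v_def)
  then have "\<tau> *\<^sub>R v \<in> subdifferential (\<lambda>x. ereal \<tau> * stacked_sum f x) (\<chi> i. a)"
    by (simp add: scaleR_in_subdifferential_scale[OF \<tau>])
  moreover have "- (\<tau> *\<^sub>R v) - \<tau> *\<^sub>R D \<in> range (disagreement W)"
  proof (rule zero_row_sum_in_range_disagreement[OF W])
    have "(\<Sum>i\<in>UNIV. (- (\<tau> *\<^sub>R v) - \<tau> *\<^sub>R D) $ i) = - (\<tau> *\<^sub>R ((\<Sum>i\<in>UNIV. \<xi> i) + (\<Sum>i\<in>UNIV. D $ i)))"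
      by (simp add: v_def sum_subtractf sum_negf scaleR_sum_right scaleR_add_right)
    then show "(\<Sum>i\<in>UNIV. (- (\<tau> *\<^sub>R v) - \<tau> *\<^sub>R D) $ i) = 0" by (simp add: \<xi>(1)[symmetric])
  qed
  then obtain r where r: "- (\<tau> *\<^sub>R v) - \<tau> *\<^sub>R D = disagreement W r" by blast
  have "\<tau> *\<^sub>R v = - disagreement W r - \<tau> *\<^sub>R D" by (simp add: r[symmetric])
  ultimately show thesis using that[of r] by simp
qed

text \<open>Conversely, values of \<open>disagreement W\<close> have row sum \<open>0\<close>, so the multiplier disappears when the
  rows of the inclusion are added.\<close>

lemma consensus_subgradient:
  fixes f :: "'n::finite \<Rightarrow> real^'p \<Rightarrow> ereal" and W :: "real^'n^'n"
  assumes W: "mixing_matrix E W" and \<tau>: "\<tau> > 0" and ker: "disagreement W x = 0"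
    and v: "- disagreement W r - \<tau> *\<^sub>R D \<in> subdifferential (\<lambda>x. ereal \<tau> * stacked_sum f x) x"
  obtains a where "x = (\<chi> i. a)"
    "- (\<Sum>i\<in>UNIV. D $ i) \<in> subdifferential (\<lambda>a. \<Sum>i\<in>UNIV. f i a) a"
proof -
  have "\<forall>i j. x $ i = x $ j" using ker disagreement_eq_0_iff[OF W] by blast
  then have x: "x = (\<chi> i. x $ undefined)" unfolding vec_eq_iff vec_lambda_beta by blast
  let ?v = "(1/\<tau>) *\<^sub>R (- disagreement W r - \<tau> *\<^sub>R D)"
  have "\<tau> *\<^sub>R ?v \<in> subdifferential (\<lambda>x. ereal \<tau> * stacked_sum f x) x" using v \<tau> by simp
  then have "?v \<in> subdifferential (stacked_sum f) (\<chi> i. x $ undefined)"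
    using scaleR_in_subdifferential_scale[OF \<tau>] x by metis
  then have "(\<Sum>i\<in>UNIV. ?v $ i) \<in> subdifferential (\<lambda>a. \<Sum>i\<in>UNIV. f i a) (x $ undefined)"
    by (rule row_sum_in_subdifferential_of_sum)
  moreover have "(\<Sum>i\<in>UNIV. ?v $ i) = (1/\<tau>) *\<^sub>R (- (\<Sum>i\<in>UNIV. disagreement W r $ i) - \<tau> *\<^sub>R (\<Sum>i\<in>UNIV. D $ i))"
    by (simp add: scaleR_sum_right sum_subtractf sum_negf scaleR_diff_right)
  ultimately show thesis using that[OF x] \<tau> by (simp add: row_sum_disagreement[OF W])
qed

section \<open>Convergence to a saddle-point\<close>

theorem theorem5p1:
  fixes L \<tau> :: real
    and f :: "'n::finite \<Rightarrow> real^'p \<Rightarrow> ereal"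
    and g :: "'n \<Rightarrow> real^'d \<Rightarrow> ereal"
    and \<phi> :: "'n \<Rightarrow> (real^'p) \<times> (real^'d) \<Rightarrow> real"
    and E1 E2 :: "('n \<times> 'n) set"
    and W1 W2 :: "real^'n^'n"
    and x vx ux :: "nat \<Rightarrow> real^'p^'n"
    and y vy uy :: "nat \<Rightarrow> real^'d^'n"
  assumes "L > 0"
    and "\<And>i. proper (f i)" "\<And>i. lower_semicontinuous (f i)" "\<And>i. ereal_convex (f i)"
    and "\<And>i. proper (g i)" "\<And>i. lower_semicontinuous (g i)" "\<And>i. ereal_convex (g i)"
    and "\<And>i. \<phi> i differentiable_on UNIV"
    and "\<And>i b. convex_on UNIV (\<lambda>a. \<phi> i (a, b))"
    and "\<And>i a. concave_on UNIV (\<lambda>b. \<phi> i (a, b))"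
    and "\<And>i. L-lipschitz_on UNIV (gradient (\<phi> i))"
    and "\<exists>a b. saddle_point f \<phi> g a b"
    and "subdifferential (\<lambda>a. \<Sum>i\<in>UNIV. f i a) = (\<lambda>a. \<Sum>i\<in>UNIV. subdifferential (f i) a)"
    and "subdifferential (\<lambda>b. \<Sum>i\<in>UNIV. g i b) = (\<lambda>b. \<Sum>i\<in>UNIV. subdifferential (g i) b)"
    and "simple_connected_graph E1" "mixing_matrix E1 W1"
    and "simple_connected_graph E2" "mixing_matrix E2 W2"
    and "0 < \<tau>" "\<tau> < (1 + min (lambda_min W1) (lambda_min W2)) / (4 * L)"
    and "vx 0 = grad_x \<phi> (x 0) (y 0)"
    and "ux 1 = x 0 - \<tau> *\<^sub>R vx 0"
    and "x 1 = prox (\<lambda>a. ereal \<tau> * stacked_sum f a) (ux 1)"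
    and "vy 0 = - grad_y \<phi> (x 0) (y 0)"
    and "uy 1 = y 0 - \<tau> *\<^sub>R vy 0"
    and "y 1 = prox (\<lambda>b. ereal \<tau> * stacked_sum g b) (uy 1)"
    and "\<And>k. k \<ge> 1 \<Longrightarrow>
           vx k = 2 *\<^sub>R grad_x \<phi> (x k) (y k) - grad_x \<phi> (x (k - 1)) (y (k - 1))"
    and "\<And>k. k \<ge> 1 \<Longrightarrow>
           ux (k + 1) = W1 ** x k + ux k - ((1/2) *\<^sub>R (mat 1 + W1)) ** x (k - 1)
                        - \<tau> *\<^sub>R (vx k - vx (k - 1))"
    and "\<And>k. k \<ge> 1 \<Longrightarrow> x (k + 1) = prox (\<lambda>a. ereal \<tau> * stacked_sum f a) (ux (k + 1))"
    and "\<And>k. k \<ge> 1 \<Longrightarrow>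
           vy k = - 2 *\<^sub>R grad_y \<phi> (x k) (y k) + grad_y \<phi> (x (k - 1)) (y (k - 1))"
    and "\<And>k. k \<ge> 1 \<Longrightarrow>
           uy (k + 1) = W2 ** y k + uy k - ((1/2) *\<^sub>R (mat 1 + W2)) ** y (k - 1)
                        - \<tau> *\<^sub>R (vy k - vy (k - 1))"
    and "\<And>k. k \<ge> 1 \<Longrightarrow> y (k + 1) = prox (\<lambda>b. ereal \<tau> * stacked_sum g b) (uy (k + 1))"
  shows "\<exists>a b. saddle_point f \<phi> g a b \<and> x \<longlonglongrightarrow> (\<chi> i. a) \<and> y \<longlonglongrightarrow> (\<chi> i. b)"
proof -
  interpret smooth_coupling \<phi> L
    using assms(8-11) by unfold_locales
  have f_ninf: "f i a \<noteq> -\<infinity>" and g_ninf: "g i b \<noteq> -\<infinity>" for i a b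
    using assms(2,5) by (simp_all add: proper_def)
  note saddle_iff = saddle_point_iff[where f = f and g = g, OF f_ninf assms(4) g_ninf assms(7)]
  define fs where "fs a = ereal \<tau> * stacked_sum f a" for a
  define gs where "gs b = ereal \<tau> * stacked_sum g b" for b
  note fs = stacked_sum_regular[where f = f, OF assms(2-4) \<open>0 < \<tau>\<close>, folded fs_def[abs_def], folded fs_def]
  note gs = stacked_sum_regular[where f = g, OF assms(5-7) \<open>0 < \<tau>\<close>, folded gs_def[abs_def], folded gs_def]
  note W1 = \<open>mixing_matrix E1 W1\<close> and W2 = \<open>mixing_matrix E2 W2\<close>
  have sum_grad_x: "(\<Sum>i\<in>UNIV. grad_x \<phi> (\<chi> i. a) (\<chi> i. b) $ i) =
      (\<Sum>i\<in>UNIV. fst (gradient (\<phi> i) (a, b)))" for a b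
    by (simp add: grad_x_eq)
  have sum_grad_y: "- (\<Sum>i\<in>UNIV. (- grad_y \<phi> (\<chi> i. a) (\<chi> i. b)) $ i) =
      (\<Sum>i\<in>UNIV. snd (gradient (\<phi> i) (a, b)))" for a b
    by (simp add: grad_y_eq sum_negf)

  \<comment> \<open>the given saddle-point, as a solution of the stacked inclusion with multipliers \<open>r1\<close>, \<open>r2\<close>\<close>
  obtain a0 b0 where "saddle_point f \<phi> g a0 b0" using assms(12) by blast
  then have sub_x0: "- (\<Sum>i\<in>UNIV. grad_x \<phi> (\<chi> i. a0) (\<chi> i. b0) $ i)
        \<in> subdifferential (\<lambda>a. \<Sum>i\<in>UNIV. f i a) a0"
    and sub_y0: "- (\<Sum>i\<in>UNIV. (- grad_y \<phi> (\<chi> i. a0) (\<chi> i. b0)) $ i)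
        \<in> subdifferential (\<lambda>b. \<Sum>i\<in>UNIV. g i b) b0"
    unfolding saddle_iff sum_grad_x sum_grad_y by blast+
  define z0 :: "(real^'p^'n) \<times> (real^'d^'n)" where "z0 = (\<chi> i. a0, \<chi> i. b0)"
  obtain r1 where r1: "- disagreement W1 r1 - \<tau> *\<^sub>R grad_x \<phi> (fst z0) (snd z0) \<in> subdifferential fs (fst z0)"
    using stacked_subgradient_exists[OF assms(13) sub_x0 W1 \<open>0 < \<tau>\<close>]
    unfolding z0_def fs_def[abs_def] by auto
  obtain r2 where r2: "- disagreement W2 r2 - \<tau> *\<^sub>R (- grad_y \<phi> (fst z0) (snd z0)) \<in> subdifferential gs (snd z0)"
    using stacked_subgradient_exists[OF assms(14) sub_y0 W2 \<open>0 < \<tau>\<close>]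
    unfolding z0_def gs_def[abs_def] by auto

  \<comment> \<open>that solution also provides the subgradients that make the proximal maps well defined\<close>
  have res_x: "ux (k+1) - x (k+1) \<in> subdifferential fs (x (k+1))" for k
  proof -
    have "x (k+1) = prox fs (ux (k+1))"
      using assms(23) assms(29)[of k] by (cases "k = 0") (simp_all add: fs_def[abs_def])
    then show ?thesis using prox_residual_in_subdifferential[OF fs r1] by simp
  qed
  have res_y: "uy (k+1) - y (k+1) \<in> subdifferential gs (y (k+1))" for k
  proof -
    have "y (k+1) = prox gs (uy (k+1))"
      using assms(26) assms(32)[of k] by (cases "k = 0") (simp_all add: gs_def[abs_def])
    then show ?thesis using prox_residual_in_subdifferential[OF gs r2] by simp
  qed

  \<comment> \<open>both variables together form one iteration in the product space; the bound on \<open>\<tau>\<close> is exactly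
    \<open>2 * (\<tau> * L) < \<sigma>\<close>\<close>
  define U where "U z = (disagreement W1 (fst z), disagreement W2 (snd z))"
    for z :: "(real^'p^'n) \<times> (real^'d^'n)"
  define F where "F z = \<tau> *\<^sub>R saddle_operator z" for z
  define T where "T z = subdifferential fs (fst z) \<times> subdifferential gs (snd z)" for z
  define z where "z k = (x k, y k)" for k
  define s where "s k = ((\<Sum>j=1..k. x j) - x 0, (\<Sum>j=1..k. y j) - y 0)" for k
  define \<sigma> where "\<sigma> = (1 + min (lambda_min W1) (lambda_min W2)) / 2"
  interpret U1: psd_operator "disagreement W1 :: real^'p^'n \<Rightarrow> _" by (rule disagreement_psd[OF W1])
  interpret U2: psd_operator "disagreement W2 :: real^'d^'n \<Rightarrow> _" by (rule disagreement_psd[OF W2])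
  interpret reflected_iteration U F T "\<tau> * L" \<sigma> z s
  proof (intro reflected_iteration.intro psd_operator.intro reflected_iteration_axioms.intro)
    show "linear U"
      by (rule linearI)
        (simp_all add: U_def linear_add[OF U1.linear] linear_add[OF U2.linear]
          linear_scale[OF U1.linear] linear_scale[OF U2.linear])
    show "U a \<bullet> b = a \<bullet> U b" for a b by (simp add: U_def inner_prod_def U1.symmetric U2.symmetric)
    show "0 \<le> a \<bullet> U a" for a by (simp add: U_def inner_prod_def U1.nonneg U2.nonneg)
    show "\<sigma> * (norm a)\<^sup>2 \<le> a \<bullet> (a - U a)" for a
    proof -
      have "\<sigma> * (norm (fst a))\<^sup>2 \<le> (1 + lambda_min W1) / 2 * (norm (fst a))\<^sup>2"
        "\<sigma> * (norm (snd a))\<^sup>2 \<le> (1 + lambda_min W2) / 2 * (norm (snd a))\<^sup>2"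
        by (intro mult_right_mono; simp add: \<sigma>_def)+
      moreover have "\<sigma> * (norm a)\<^sup>2 = \<sigma> * (norm (fst a))\<^sup>2 + \<sigma> * (norm (snd a))\<^sup>2"
        by (simp add: power2_norm_eq_inner inner_prod_def distrib_left)
      moreover have "a \<bullet> (a - U a) = fst a \<bullet> (fst a - disagreement W1 (fst a))
          + snd a \<bullet> (snd a - disagreement W2 (snd a))"
        by (simp add: U_def inner_prod_def)
      ultimately show ?thesis
        using disagreement_coercive[OF W1, of "fst a"] disagreement_coercive[OF W2, of "snd a"]
        by linarith
    qed
    show "0 \<le> (F a - F b) \<bullet> (a - b)" for a b
      using saddle_operator_monotone[of a b] \<open>0 < \<tau>\<close>
      by (simp add: F_def scaleR_diff_right[symmetric])
    show "norm (F a - F b) \<le> \<tau> * L * norm (a - b)" for a b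
      using saddle_operator_lipschitz[of a b] \<open>0 < \<tau>\<close>
      by (simp add: F_def scaleR_diff_right[symmetric] mult.assoc)
    show "0 \<le> (v - w) \<bullet> (a - b)" if "v \<in> T a" "w \<in> T b" for v w a b
    proof -
      have "0 \<le> (fst v - fst w) \<bullet> (fst a - fst b)" "0 \<le> (snd v - snd w) \<bullet> (snd a - snd b)"
        using that unfolding T_def
        by (auto intro: subdifferential_monotone[OF _ _ fs(3)] subdifferential_monotone[OF _ _ gs(3)])
      then show ?thesis by (simp add: inner_prod_def)
    qed
    show "v \<in> T a" if vs: "\<And>k::nat. vs k \<in> T (as k)" and lim: "as \<longlonglongrightarrow> a" "vs \<longlonglongrightarrow> v" for vs as a v
    proof -
      have "fst v \<in> subdifferential fs (fst a)"
        using vs unfolding T_def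
        by (intro subdifferential_closed_graph[OF fs(1,3) _ tendsto_fst[OF lim(1)] tendsto_fst[OF lim(2)]])
          (simp add: mem_Times_iff)
      moreover have "snd v \<in> subdifferential gs (snd a)"
        using vs unfolding T_def
        by (intro subdifferential_closed_graph[OF gs(1,3) _ tendsto_snd[OF lim(1)] tendsto_snd[OF lim(2)]])
          (simp add: mem_Times_iff)
      ultimately show ?thesis by (simp add: T_def mem_Times_iff)
    qed
    show "0 \<le> \<tau> * L" using \<open>0 < \<tau>\<close> \<open>L > 0\<close> by simp
    show "2 * (\<tau> * L) < \<sigma>"
      using assms(20) \<open>L > 0\<close> by (simp add: \<sigma>_def field_simps)
    show "s (k+2) = s (k+1) + z (k+2)" for k by (simp add: s_def z_def)
    show "(z (k+1) - z (k+2)) - U (z (k+1) - z (k+2)) - U (s (k+2))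
        - (2 *\<^sub>R F (z (k+1)) - F (z k)) \<in> T (z (k+2))" for k
    proof -
      have "(z (k+1) - z (k+2)) - U (z (k+1) - z (k+2)) - U (s (k+2)) - (2 *\<^sub>R F (z (k+1)) - F (z k))
          = ((x (k+1) - x (k+2)) - disagreement W1 (x (k+1) - x (k+2))
              - disagreement W1 ((\<Sum>j=1..k+2. x j) - x 0) - \<tau> *\<^sub>R vx (k+1),
            (y (k+1) - y (k+2)) - disagreement W2 (y (k+1) - y (k+2))
              - disagreement W2 ((\<Sum>j=1..k+2. y j) - y 0) - \<tau> *\<^sub>R vy (k+1))"
        using assms(27)[of "k+1"] assms(30)[of "k+1"]
        by (simp add: z_def U_def s_def F_def saddle_operator_def scaleR_diff_right)
      also have "\<dots> = (ux (k+2) - x (k+2), uy (k+2) - y (k+2))"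
        by (simp only: mixing_recursion_residual[where u = ux and x = x and v = vx and W = W1, OF assms(22,28)]
            mixing_recursion_residual[where u = uy and x = y and v = vy and W = W2, OF assms(25,31)])
      finally have "(z (k+1) - z (k+2)) - U (z (k+1) - z (k+2)) - U (s (k+2))
          - (2 *\<^sub>R F (z (k+1)) - F (z k)) = (ux (k+2) - x (k+2), uy (k+2) - y (k+2))" .
      then show ?thesis
        using res_x[of "k+1"] res_y[of "k+1"] by (simp add: T_def z_def)
    qed
  qed

  have "disagreement W1 (fst z0) = 0" "disagreement W2 (snd z0) = 0"
    unfolding z0_def by (simp_all add: disagreement_eq_0_iff[OF W1] disagreement_eq_0_iff[OF W2])
  then have "kkt z0 (r1, r2)"
    using r1 r2 by (simp add: kkt_def U_def F_def T_def saddle_operator_def zero_prod_def)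
  then obtain zl r where kkt: "kkt zl r" and lim: "z \<longlonglongrightarrow> zl" by (rule converges_to_kkt)
  \<comment> \<open>the limit has equal rows, and adding the rows of its inclusion turns it into a saddle-point\<close>
  have "disagreement W1 (fst zl) = 0"
    "- disagreement W1 (fst r) - \<tau> *\<^sub>R grad_x \<phi> (fst zl) (snd zl) \<in> subdifferential fs (fst zl)"
    using kkt by (simp_all add: kkt_def U_def F_def T_def saddle_operator_def zero_prod_def)
  then obtain a where a: "fst zl = (\<chi> i. a)"
    and sub_x: "- (\<Sum>i\<in>UNIV. grad_x \<phi> (fst zl) (snd zl) $ i)
        \<in> subdifferential (\<lambda>a. \<Sum>i\<in>UNIV. f i a) a"
    unfolding fs_def[abs_def] by (rule consensus_subgradient[OF W1 \<open>0 < \<tau>\<close>])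
  have "disagreement W2 (snd zl) = 0"
    "- disagreement W2 (snd r) - \<tau> *\<^sub>R (- grad_y \<phi> (fst zl) (snd zl)) \<in> subdifferential gs (snd zl)"
    using kkt by (simp_all add: kkt_def U_def F_def T_def saddle_operator_def zero_prod_def)
  then obtain b where b: "snd zl = (\<chi> i. b)"
    and sub_y: "- (\<Sum>i\<in>UNIV. (- grad_y \<phi> (fst zl) (snd zl)) $ i)
        \<in> subdifferential (\<lambda>b. \<Sum>i\<in>UNIV. g i b) b"
    unfolding gs_def[abs_def] by (rule consensus_subgradient[OF W2 \<open>0 < \<tau>\<close>])
  have "saddle_point f \<phi> g a b"
    unfolding saddle_iff using sub_x sub_y unfolding a b sum_grad_x sum_grad_y by blast
  moreover have "x \<longlonglongrightarrow> (\<chi> i. a)" "y \<longlonglongrightarrow> (\<chi> i. b)"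
    using tendsto_fst[OF lim] tendsto_snd[OF lim] unfolding a b by (simp_all add: z_def)
  ultimately show ?thesis by blast
qed

end
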